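(* Let $\nu>0$, $\lambda>0$, $\alpha\ge 0$. Let $f\in C(\mathbb R,\ell_2)$ be almost periodic. Let $F\in C(\mathbb R,\mathbb R)$ be Lipschitz continuous on bounded sets with $F(0)=0$, and suppose that $$(x_1-x_2)(F(x_1)-F(x_2))\le -\alpha|x_1-x_2|^2\qquad\text{for all }x_1,x_2\in\mathbb R.$$ Then the cocycle $\langle\ell_2,\varphi,(H(f),\mathbb R,\sigma)\rangle$ generated by the equation $u'=\nu\Lambda u-\lambda u+\widetilde F(u)+f(t)$ has a compact global attractor $\{I_g\mid g\in H(f)\}$.
   Context: $\ell_2$ is the Hilbert space of real two-sided square-summable sequences $(\xi_i)_{i\in\mathbb Z}$ with $\langle\xi,\eta\rangle=\sum_{i\in\mathbb Z}\xi_i\eta_i$ and norm $\|\xi\|^2=\langle\xi,\xi\rangle$; $\mathbb R_+=[0,\infty)$. The discrete Laplacian $\Lambda:\ell_2\to\ell_2$ is $(\Lambda u)_i=u_{i-1}-2u_i+u_{i+1}$. The Nemytskii operator $\widetilde F:\ell_2\to\ell_2$ is $\widetilde F(\xi)_i=F(\xi_i)$ (well defined because $F$ is locally Lipschitz and $F(0)=0$). A set $A\subset\mathbb R$ is relatively dense if there is $l>0$ with $A\cap[a,a+l]\neq\emptyset$ for all $a\in\mathbb R$. A function $f\in C(\mathbb R,\ell_2)$ is almost periodic if for every $\varepsilon>0$ the set $\{\tau\in\mathbb R:\ \|f(t+\tau)-f(t)\|<\varepsilon\ \forall t\in\mathbb R\}$ is relatively dense. $C(\mathbb R,\ell_2)$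 carries the compact-open topology (uniform convergence on compact intervals). For $g\in C(\mathbb R,\ell_2)$ and $h\in\mathbb R$, $\sigma(h,g)=g^h$ with $g^h(t)=g(t+h)$. $H(f)$ is the closure of $\{f^h: h\in\mathbb R\}$ in $C(\mathbb R,\ell_2)$. Under the hypotheses it is known that for every $(v,g)\in\ell_2\times H(f)$ the equation $u'=\nu\Lambda u-\lambda u+\widetilde F(u)+g(t)$ has a unique solution $\varphi(t,v,g)$ on $\mathbb R_+$ with $\varphi(0,v,g)=v$; the map $\varphi:\mathbb R_+\times\ell_2\times H(f)\to\ell_2$ is continuous and $\varphi(t+\tau,v,g)=\varphi(t,\varphi(\tau,v,g),g^\tau)$. This $\varphi$ is the cocycle generated by the equation. A family $I=\{I_g\mid g\in H(f)\}$ of compact subsets of $\ell_2$ is a compact global attractor for $\varphi$ if: (1) $\mathcal I=\bigcup_{g\in H(f)}I_g$ is precompact; (2) $\varphi(t,I_g,g)=I_{\sigma(t,g)}$ for all $(t,g)\in\mathbb R_+\times H(f)$; (3) $\lim_{t\to+\infty}\sup_{g\in H(f)}\beta(\varphi(t,M,g),\mathcal I)=0$ for every compact $M\subset\ell_2$, where $\beta(A,B)=\sup_{a\in A}\inf_{b\in B}\|a-b\|$ and $\varphi(t,M,g)=\{\varphi(t,v,g):v\in M\}$. *)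

theory Defs
  imports "HOL-Analysis.Analysis"
begin

section \<open>The Hilbert space of square-summable two-sided real sequences\<close>

definition square_summable :: "(int \<Rightarrow> real) \<Rightarrow> bool" where
  "square_summable x \<longleftrightarrow> (\<lambda>i. (x i)\<^sup>2) summable_on UNIV"

typedef ell2 = "{x. square_summable x}"
  morphisms coord Abs_ell2
  by (rule exI[of _ "\<lambda>_. 0"]) (simp add: square_summable_def)

lemma square_summable_coord [simp]: "square_summable (coord u)"
  using coord by simp

lemma coord_Abs_ell2: "square_summable x \<Longrightarrow> coord (Abs_ell2 x) = x"
  by (simp add: Abs_ell2_inverse)

lemma ell2_eqI: "(\<And>i. coord u i = coord v i) \<Longrightarrow> u = v"
  by (metis coord_inject ext)

lemma square_summable_dominated:
  assumes "square_summable x" and "\<And>i. \<bar>y i\<bar> \<le> C * \<bar>x i\<bar>"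
  shows "square_summable y"
  unfolding square_summable_def
proof (rule summable_on_comparison_test)
  show "(\<lambda>i. C\<^sup>2 * (x i)\<^sup>2) summable_on UNIV"
    using assms(1) unfolding square_summable_def by (intro summable_on_cmult_right)
  show "(y i)\<^sup>2 \<le> C\<^sup>2 * (x i)\<^sup>2" for i
    using power_mono[OF assms(2)[of i], of 2] by (simp add: power_mult_distrib)
qed simp

lemma square_summable_0 [simp]: "square_summable (\<lambda>_. 0)"
  by (simp add: square_summable_def)

lemma square_summable_scale: "square_summable x \<Longrightarrow> square_summable (\<lambda>i. c * x i)"
  by (erule square_summable_dominated[where C = "\<bar>c\<bar>"]) (simp add: abs_mult)

lemma square_summable_uminus: "square_summable x \<Longrightarrow> square_summable (\<lambda>i. - x i)"
  using square_summable_scale[of x "-1"] by simp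

lemma square_summable_add:
  assumes "square_summable x" "square_summable y"
  shows "square_summable (\<lambda>i. x i + y i)"
  unfolding square_summable_def
proof (rule summable_on_comparison_test)
  show "(\<lambda>i. 2 * (x i)\<^sup>2 + 2 * (y i)\<^sup>2) summable_on UNIV"
    using assms unfolding square_summable_def
    by (intro summable_on_add summable_on_cmult_right)
  show "(x i + y i)\<^sup>2 \<le> 2 * (x i)\<^sup>2 + 2 * (y i)\<^sup>2" for i
    using zero_le_power2[of "x i - y i"] by (simp add: power2_eq_square algebra_simps)
qed simp

lemma square_summable_diff:
  assumes "square_summable x" "square_summable y"
  shows "square_summable (\<lambda>i. x i - y i)"
  using square_summable_add[OF assms(1) square_summable_uminus[OF assms(2)]] by simp

lemma square_summable_shift:
  assumes "square_summable x"
  shows "square_summable (\<lambda>i. x (i + k))"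
proof -
  have "bij_betw (\<lambda>i::int. i + k) UNIV UNIV"
    by (rule bij_betw_byWitness[where f' = "\<lambda>i. i - k"]) auto
  from summable_on_reindex_bij_betw[OF this, of "\<lambda>i. (x i)\<^sup>2"]
  show ?thesis using assms by (simp add: square_summable_def)
qed

lemma square_summable_mult:
  assumes "square_summable x" "square_summable y"
  shows "(\<lambda>i. x i * y i) summable_on UNIV"
proof (rule abs_summable_summable, rule summable_on_comparison_test)
  show "(\<lambda>i. (x i)\<^sup>2 + (y i)\<^sup>2) summable_on UNIV"
    using assms unfolding square_summable_def by (intro summable_on_add)
  show "norm (x i * y i) \<le> (x i)\<^sup>2 + (y i)\<^sup>2" for i
  proof -
    have "2 * (\<bar>x i\<bar> * \<bar>y i\<bar>) \<le> (x i)\<^sup>2 + (y i)\<^sup>2"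
      using zero_le_power2[of "\<bar>x i\<bar> - \<bar>y i\<bar>"] by (simp add: power2_eq_square algebra_simps)
    moreover have "0 \<le> \<bar>x i\<bar> * \<bar>y i\<bar>" by simp
    ultimately show ?thesis unfolding real_norm_def abs_mult by linarith
  qed
qed simp

instantiation ell2 :: real_inner
begin

definition "0 = Abs_ell2 (\<lambda>_. 0)"
definition "u + v = Abs_ell2 (\<lambda>i. coord u i + coord v i)"
definition "u - v = Abs_ell2 (\<lambda>i. coord u i - coord v i)"
definition "- u = Abs_ell2 (\<lambda>i. - coord u i)"
definition "scaleR c u = Abs_ell2 (\<lambda>i. c * coord u i)"
definition inner_ell2 :: "ell2 \<Rightarrow> ell2 \<Rightarrow> real" where
  "inner_ell2 u v = (\<Sum>\<^sub>\<infinity>i. coord u i * coord v i)"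
definition norm_ell2 :: "ell2 \<Rightarrow> real" where
  "norm_ell2 u = sqrt (inner u u)"
definition dist_ell2 :: "ell2 \<Rightarrow> ell2 \<Rightarrow> real" where
  "dist_ell2 u v = norm (u - v)"
definition sgn_ell2 :: "ell2 \<Rightarrow> ell2" where
  "sgn_ell2 u = scaleR (inverse (norm u)) u"
definition uniformity_ell2 :: "(ell2 \<times> ell2) filter" where
  "uniformity_ell2 = (INF e\<in>{0<..}. principal {(u, v). dist u v < e})"
definition open_ell2 :: "ell2 set \<Rightarrow> bool" where
  "open_ell2 U \<longleftrightarrow> (\<forall>x\<in>U. eventually (\<lambda>(x', y). x' = x \<longrightarrow> y \<in> U) uniformity)"

lemma coord_zero_ell2: "coord 0 i = 0"
  by (simp add: zero_ell2_def coord_Abs_ell2)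
lemma coord_plus_ell2: "coord (u + v) i = coord u i + coord v i"
  by (simp add: plus_ell2_def coord_Abs_ell2 square_summable_add)
lemma coord_minus_ell2: "coord (u - v) i = coord u i - coord v i"
  by (simp add: minus_ell2_def coord_Abs_ell2 square_summable_diff)
lemma coord_uminus_ell2: "coord (- u) i = - coord u i"
  by (simp add: uminus_ell2_def coord_Abs_ell2 square_summable_uminus)
lemma coord_scaleR_ell2: "coord (scaleR c u) i = c * coord u i"
  by (simp add: scaleR_ell2_def coord_Abs_ell2 square_summable_scale)

lemmas coord_ell2_simps =
  coord_zero_ell2 coord_plus_ell2 coord_minus_ell2 coord_uminus_ell2 coord_scaleR_ell2

instance
proof
  fix u v w :: ell2 and a b :: real
  show "u + v + w = u + (v + w)" "u + v = v + u" "0 + u = u" "- u + u = 0" "u - v = u + - v"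
    "a *\<^sub>R (u + v) = a *\<^sub>R u + a *\<^sub>R v" "(a + b) *\<^sub>R u = a *\<^sub>R u + b *\<^sub>R u"
    "a *\<^sub>R b *\<^sub>R u = (a * b) *\<^sub>R u" "1 *\<^sub>R u = u"
    by (rule ell2_eqI, simp add: coord_ell2_simps algebra_simps)+
  show "dist u v = norm (u - v)" by (rule dist_ell2_def)
  show "sgn u = inverse (norm u) *\<^sub>R u" by (rule sgn_ell2_def)
  show "uniformity = (INF e\<in>{0<..}. principal {(u, v :: ell2). dist u v < e})"
    by (rule uniformity_ell2_def)
  show "open U \<longleftrightarrow> (\<forall>x\<in>U. eventually (\<lambda>(x', y). x' = x \<longrightarrow> y \<in> U) uniformity)"
    for U :: "ell2 set" by (rule open_ell2_def)
  have prod: "(\<lambda>i. coord x i * coord y i) summable_on UNIV" for x y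
    by (simp add: square_summable_mult)
  show "inner u v = inner v u" by (simp add: inner_ell2_def mult.commute)
  show "inner (u + v) w = inner u w + inner v w"
    by (simp add: inner_ell2_def coord_ell2_simps distrib_right infsum_add prod)
  show "inner (a *\<^sub>R u) v = a * inner u v"
    by (simp add: inner_ell2_def coord_ell2_simps mult.assoc infsum_cmult_right prod)
  show "0 \<le> inner u u" unfolding inner_ell2_def by (rule infsum_nonneg) simp
  show "inner u u = 0 \<longleftrightarrow> u = 0"
  proof
    assume *: "inner u u = 0"
    show "u = 0"
    proof (rule ell2_eqI)
      fix i
      have "coord u i * coord u i = 0"
        by (rule nonneg_infsum_le_0D[where A = UNIV and f = "\<lambda>i. coord u i * coord u i"])
          (use * prod in \<open>auto simp: inner_ell2_def\<close>)
      then show "coord u i = coord 0 i" by (simp add: coord_ell2_simps)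
    qed
  qed (simp add: inner_ell2_def coord_ell2_simps)
  show "norm u = sqrt (inner u u)" by (rule norm_ell2_def)
qed

end

lemma norm_ell2_power2: "(norm u)\<^sup>2 = (\<Sum>\<^sub>\<infinity>i. (coord u i)\<^sup>2)"
  unfolding power2_norm_eq_inner inner_ell2_def by (simp add: power2_eq_square)

lemma sum_coord_le_norm:
  assumes "finite B"
  shows "(\<Sum>i\<in>B. (coord u i)\<^sup>2) \<le> (norm u)\<^sup>2"
  unfolding norm_ell2_power2
  by (rule finite_sum_le_infsum)
    (use assms square_summable_coord[of u] in \<open>auto simp: square_summable_def\<close>)

lemma abs_coord_le_norm: "\<bar>coord u i\<bar> \<le> norm u"
proof -
  have "\<bar>coord u i\<bar>\<^sup>2 \<le> (norm u)\<^sup>2" using sum_coord_le_norm[of "{i}" u] by simp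
  then show ?thesis by (rule power2_le_imp_le) simp
qed

instance ell2 :: banach
proof
  fix X :: "nat \<Rightarrow> ell2"
  assume X: "Cauchy X"
  define x where "x i = lim (\<lambda>n. coord (X n) i)" for i
  have lim: "(\<lambda>n. coord (X n) i) \<longlonglongrightarrow> x i" for i
  proof -
    have "Cauchy (\<lambda>n. coord (X n) i)"
    proof (rule metric_CauchyI)
      fix e :: real assume "0 < e"
      then obtain M where M: "\<forall>m\<ge>M. \<forall>n\<ge>M. dist (X m) (X n) < e"
        using metric_CauchyD[OF X] by blast
      have "dist (coord (X m) i) (coord (X n) i) \<le> dist (X m) (X n)" for m n
        using abs_coord_le_norm[of "X m - X n" i]
        by (simp add: dist_norm coord_ell2_simps)
      then show "\<exists>M. \<forall>m\<ge>M. \<forall>n\<ge>M. dist (coord (X m) i) (coord (X n) i) < e"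
        using M by (meson le_less_trans)
    qed
    then show ?thesis
      unfolding x_def by (simp add: Cauchy_convergent_iff convergent_LIMSEQ_iff)
  qed
  have tail: "\<exists>M. \<forall>n\<ge>M. \<forall>B. finite B \<longrightarrow> (\<Sum>i\<in>B. (coord (X n) i - x i)\<^sup>2) \<le> e\<^sup>2"
    if e: "0 < e" for e
  proof -
    obtain M where M: "\<forall>m\<ge>M. \<forall>n\<ge>M. dist (X m) (X n) < e"
      using metric_CauchyD[OF X e] by blast
    have "(\<Sum>i\<in>B. (coord (X n) i - x i)\<^sup>2) \<le> e\<^sup>2" if "n \<ge> M" "finite B" for n B
    proof (rule LIMSEQ_le_const2)
      show "(\<lambda>m. \<Sum>i\<in>B. (coord (X n) i - coord (X m) i)\<^sup>2)
              \<longlonglongrightarrow> (\<Sum>i\<in>B. (coord (X n) i - x i)\<^sup>2)"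
        by (intro tendsto_sum tendsto_power tendsto_diff tendsto_const lim)
      have "(\<Sum>i\<in>B. (coord (X n) i - coord (X m) i)\<^sup>2) \<le> e\<^sup>2" if "m \<ge> M" for m
      proof -
        have "(\<Sum>i\<in>B. (coord (X n) i - coord (X m) i)\<^sup>2) \<le> (norm (X n - X m))\<^sup>2"
          using sum_coord_le_norm[OF \<open>finite B\<close>, of "X n - X m"]
          by (simp add: coord_ell2_simps)
        also have "\<dots> \<le> e\<^sup>2"
          using M \<open>n \<ge> M\<close> \<open>m \<ge> M\<close> by (intro power_mono) (auto simp: dist_norm less_imp_le)
        finally show ?thesis .
      qed
      then show "\<exists>N. \<forall>m\<ge>N. (\<Sum>i\<in>B. (coord (X n) i - coord (X m) i)\<^sup>2) \<le> e\<^sup>2" by blast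
    qed
    then show ?thesis by blast
  qed
  have diff: "square_summable (\<lambda>i. coord (X n) i - x i)"
    if "\<forall>B. finite B \<longrightarrow> (\<Sum>i\<in>B. (coord (X n) i - x i)\<^sup>2) \<le> c" for n c
    unfolding square_summable_def
    by (rule nonneg_bdd_above_summable_on) (use that in \<open>auto intro!: bdd_aboveI2\<close>)
  have "square_summable x"
  proof -
    obtain M where "\<forall>B. finite B \<longrightarrow> (\<Sum>i\<in>B. (coord (X M) i - x i)\<^sup>2) \<le> 1\<^sup>2"
      using tail[of 1] by auto
    from square_summable_diff[OF square_summable_coord[of "X M"] diff[OF this]]
    show ?thesis by simp
  qed
  then have cx: "coord (Abs_ell2 x) = x" by (rule coord_Abs_ell2)
  have "X \<longlonglongrightarrow> Abs_ell2 x"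
  proof (rule metric_LIMSEQ_I)
    fix e :: real assume e: "0 < e"
    then obtain M where
      M: "\<forall>n\<ge>M. \<forall>B. finite B \<longrightarrow> (\<Sum>i\<in>B. (coord (X n) i - x i)\<^sup>2) \<le> (e / 2)\<^sup>2"
      using tail[of "e / 2"] by auto
    have "dist (X n) (Abs_ell2 x) < e" if "n \<ge> M" for n
    proof -
      have "(norm (X n - Abs_ell2 x))\<^sup>2 \<le> (e / 2)\<^sup>2"
        unfolding norm_ell2_power2
        by (rule infsum_le_finite_sums)
          (use M that diff[of n] in \<open>auto simp: coord_ell2_simps cx square_summable_def\<close>)
      then have "norm (X n - Abs_ell2 x) \<le> e / 2"
        by (rule power2_le_imp_le) (use e in simp)
      then show ?thesis using e by (simp add: dist_norm)
    qed
    then show "\<exists>M. \<forall>n\<ge>M. dist (X n) (Abs_ell2 x) < e" by blast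
  qed
  then show "convergent X" by (rule convergentI)
qed


section \<open>The operators in the equation\<close>

definition discrete_laplacian :: "ell2 \<Rightarrow> ell2" where
  "discrete_laplacian u = Abs_ell2 (\<lambda>i. coord u (i - 1) - 2 * coord u i + coord u (i + 1))"

lemma coord_discrete_laplacian:
  "coord (discrete_laplacian u) i = coord u (i - 1) - 2 * coord u i + coord u (i + 1)"
proof -
  have "square_summable (\<lambda>i. coord u (i + - 1) - 2 * coord u i + coord u (i + 1))"
    by (intro square_summable_add square_summable_diff square_summable_shift
        square_summable_scale square_summable_coord)
  then show ?thesis by (simp add: discrete_laplacian_def coord_Abs_ell2)
qed

definition lipschitz_on_bounded_sets :: "('a::metric_space \<Rightarrow> 'b::metric_space) \<Rightarrow> bool" where
  "lipschitz_on_bounded_sets F \<longleftrightarrow> (\<forall>B. bounded B \<longrightarrow> (\<exists>L. L-lipschitz_on B F))"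

definition nemytskii :: "(real \<Rightarrow> real) \<Rightarrow> ell2 \<Rightarrow> ell2" where
  "nemytskii F u = Abs_ell2 (\<lambda>i. F (coord u i))"

lemma coord_nemytskii:
  assumes "lipschitz_on_bounded_sets F" and "F 0 = 0"
  shows "coord (nemytskii F u) i = F (coord u i)"
proof -
  have "bounded (cball (0::real) (norm u))" by simp
  then obtain L where L: "L-lipschitz_on (cball 0 (norm u)) F"
    using assms(1) unfolding lipschitz_on_bounded_sets_def by blast
  have "\<bar>F (coord u i)\<bar> \<le> L * \<bar>coord u i\<bar>" for i
    using lipschitz_onD[OF L, of "coord u i" 0] abs_coord_le_norm[of u i] assms(2)
    by (simp add: dist_norm)
  then have "square_summable (\<lambda>i. F (coord u i))"
    by (rule square_summable_dominated[OF square_summable_coord])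
  then show ?thesis by (simp add: nemytskii_def coord_Abs_ell2)
qed


section \<open>Almost periodic functions and their hulls\<close>

definition relatively_dense :: "real set \<Rightarrow> bool" where
  "relatively_dense A \<longleftrightarrow> (\<exists>l>0. \<forall>a. A \<inter> {a..a + l} \<noteq> {})"

definition almost_periodic :: "(real \<Rightarrow> 'a::real_normed_vector) \<Rightarrow> bool" where
  "almost_periodic f \<longleftrightarrow> continuous_on UNIV f \<and>
     (\<forall>\<epsilon>>0. relatively_dense {\<tau>. \<forall>t. norm (f (t + \<tau>) - f t) < \<epsilon>})"

definition translate :: "real \<Rightarrow> (real \<Rightarrow> 'a) \<Rightarrow> real \<Rightarrow> 'a" where
  "translate h g = (\<lambda>t. g (t + h))"

definition interval_nhd :: "(real \<Rightarrow> 'a::metric_space) \<Rightarrow> real \<Rightarrow> real \<Rightarrow> real \<Rightarrow> (real \<Rightarrow> 'a) set" where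
  "interval_nhd g a b \<epsilon> = {k. continuous_on UNIV k \<and> (\<forall>t\<in>{a..b}. dist (k t) (g t) < \<epsilon>)}"

text \<open>The topology of uniform convergence on compact intervals (equivalently, the compact-open
  topology) on the set of continuous functions from the real line to a metric space.\<close>

definition compact_convergence :: "(real \<Rightarrow> 'a::metric_space) topology" where
  "compact_convergence = topology (\<lambda>U. U \<subseteq> {g. continuous_on UNIV g} \<and>
     (\<forall>g\<in>U. \<exists>a b. \<exists>\<epsilon>>0. interval_nhd g a b \<epsilon> \<subseteq> U))"

lemma openin_compact_convergence:
  "openin compact_convergence U \<longleftrightarrow> U \<subseteq> {g. continuous_on UNIV g} \<and>
     (\<forall>g\<in>U. \<exists>a b. \<exists>\<epsilon>>0. interval_nhd g a b \<epsilon> \<subseteq> U)"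
proof -
  have "istopology (\<lambda>U :: (real \<Rightarrow> 'a) set. U \<subseteq> {g. continuous_on UNIV g} \<and>
     (\<forall>g\<in>U. \<exists>a b. \<exists>\<epsilon>>0. interval_nhd g a b \<epsilon> \<subseteq> U))" (is "istopology ?P")
    unfolding istopology_def
  proof (intro conjI allI impI)
    fix S T :: "(real \<Rightarrow> 'a) set"
    assume S: "?P S" and T: "?P T"
    show "S \<inter> T \<subseteq> {g. continuous_on UNIV g}" using S by blast
    show "\<forall>g\<in>S \<inter> T. \<exists>a b. \<exists>\<epsilon>>0. interval_nhd g a b \<epsilon> \<subseteq> S \<inter> T"
    proof
      fix g assume "g \<in> S \<inter> T"
      then obtain a b \<epsilon> a' b' \<epsilon>'
        where *: "\<epsilon> > 0" "interval_nhd g a b \<epsilon> \<subseteq> S" "\<epsilon>' > 0" "interval_nhd g a' b' \<epsilon>' \<subseteq> T"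
        using S T by (meson IntE)
      have "interval_nhd g (min a a') (max b b') (min \<epsilon> \<epsilon>')
              \<subseteq> interval_nhd g a b \<epsilon> \<inter> interval_nhd g a' b' \<epsilon>'"
        unfolding interval_nhd_def
        by (intro subsetI IntI CollectI conjI ballI) (force dest: bspec)+
      moreover have "min \<epsilon> \<epsilon>' > 0" using * by simp
      ultimately show "\<exists>a b. \<exists>\<epsilon>>0. interval_nhd g a b \<epsilon> \<subseteq> S \<inter> T" using * by blast
    qed
  next
    fix \<K> :: "(real \<Rightarrow> 'a) set set"
    assume K: "\<forall>K\<in>\<K>. ?P K"
    show "\<Union>\<K> \<subseteq> {g. continuous_on UNIV g}" using K by blast
    show "\<forall>g\<in>\<Union>\<K>. \<exists>a b. \<exists>\<epsilon>>0. interval_nhd g a b \<epsilon> \<subseteq> \<Union>\<K>"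
    proof
      fix g assume "g \<in> \<Union>\<K>"
      then obtain K where "K \<in> \<K>" "g \<in> K" by blast
      moreover from this K obtain a b \<epsilon> where "\<epsilon> > 0" "interval_nhd g a b \<epsilon> \<subseteq> K" by blast
      ultimately show "\<exists>a b. \<exists>\<epsilon>>0. interval_nhd g a b \<epsilon> \<subseteq> \<Union>\<K>" by blast
    qed
  qed
  then show ?thesis by (simp add: compact_convergence_def)
qed

lemma topspace_compact_convergence: "topspace compact_convergence = {g. continuous_on UNIV g}"
proof
  show "topspace compact_convergence \<subseteq> {g :: real \<Rightarrow> 'a. continuous_on UNIV g}"
    using openin_topspace openin_compact_convergence by blast
  have "openin compact_convergence {g :: real \<Rightarrow> 'a. continuous_on UNIV g}"
    unfolding openin_compact_convergence interval_nhd_def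
    by (auto intro!: exI[of _ "1::real"])
  then show "{g :: real \<Rightarrow> 'a. continuous_on UNIV g} \<subseteq> topspace compact_convergence"
    by (rule openin_subset)
qed

definition translation_hull :: "(real \<Rightarrow> 'a::metric_space) \<Rightarrow> (real \<Rightarrow> 'a) set" where
  "translation_hull f = compact_convergence closure_of (range (\<lambda>h. translate h f))"

lemma translation_hull_iff:
  assumes "continuous_on UNIV f"
  shows "g \<in> translation_hull f \<longleftrightarrow> continuous_on UNIV g \<and>
    (\<forall>a b. \<forall>\<epsilon>>0. \<exists>h. \<forall>t\<in>{a..b}. dist (f (t + h)) (g t) < \<epsilon>)" (is "_ \<longleftrightarrow> ?R")
proof
  assume g: "g \<in> translation_hull f"
  then have cg: "continuous_on UNIV g"
    unfolding translation_hull_def in_closure_of topspace_compact_convergence by simp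
  have "\<exists>h. \<forall>t\<in>{a..b}. dist (f (t + h)) (g t) < \<epsilon>" if "\<epsilon> > 0" for a b \<epsilon>
  proof -
    define V where "V = {k. continuous_on UNIV k \<and>
      (\<exists>\<delta><\<epsilon>. \<forall>t\<in>{a..b}. dist (k t) (g t) \<le> \<delta>)}"
    have "openin compact_convergence V"
      unfolding openin_compact_convergence
    proof (intro conjI ballI)
      fix k assume "k \<in> V"
      then obtain \<delta> where \<delta>: "\<delta> < \<epsilon>" "\<forall>t\<in>{a..b}. dist (k t) (g t) \<le> \<delta>"
        by (auto simp: V_def)
      have "dist (k' t) (g t) \<le> (\<delta> + \<epsilon>) / 2"
        if "dist (k' t) (k t) < (\<epsilon> - \<delta>) / 2" "t \<in> {a..b}" for k' t
      proof -
        have "dist (k' t) (g t) \<le> dist (k' t) (k t) + dist (k t) (g t)" by (rule dist_triangle)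
        moreover have "dist (k t) (g t) \<le> \<delta>" using \<delta> that by blast
        ultimately show ?thesis using that(1) by (simp add: field_simps)
      qed
      then have "interval_nhd k a b ((\<epsilon> - \<delta>) / 2) \<subseteq> V"
        using \<delta>(1) by (auto simp: interval_nhd_def V_def intro!: exI[of _ "(\<delta> + \<epsilon>) / 2"])
      moreover have "(\<epsilon> - \<delta>) / 2 > 0" using \<delta>(1) by simp
      ultimately show "\<exists>a b. \<exists>\<epsilon>>0. interval_nhd k a b \<epsilon> \<subseteq> V" by blast
    qed (auto simp: V_def)
    moreover have "g \<in> V" using cg that by (auto simp: V_def intro!: exI[of _ 0])
    ultimately obtain k where "k \<in> range (\<lambda>h. translate h f)" "k \<in> V"
      using g unfolding translation_hull_def in_closure_of by blast
    then obtain h \<delta> where "\<delta> < \<epsilon>" "\<forall>t\<in>{a..b}. dist (f (t + h)) (g t) \<le> \<delta>"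
      by (auto simp: V_def translate_def)
    then show ?thesis by (meson le_less_trans)
  qed
  with cg show ?R by blast
next
  assume R: ?R
  have "\<exists>y. y \<in> range (\<lambda>h. translate h f) \<and> y \<in> T"
    if T: "g \<in> T" "openin compact_convergence T" for T
  proof -
    from T obtain a b \<epsilon> where *: "\<epsilon> > 0" "interval_nhd g a b \<epsilon> \<subseteq> T"
      unfolding openin_compact_convergence by blast
    with R obtain h where "\<forall>t\<in>{a..b}. dist (f (t + h)) (g t) < \<epsilon>" by blast
    moreover have "continuous_on UNIV (translate h f)"
      unfolding translate_def
      by (rule continuous_on_compose2[OF assms]) (auto intro!: continuous_intros)
    ultimately have "translate h f \<in> interval_nhd g a b \<epsilon>"
      by (simp add: interval_nhd_def translate_def)
    with * show ?thesis by blast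
  qed
  then show "g \<in> translation_hull f"
    unfolding translation_hull_def in_closure_of topspace_compact_convergence using R by simp
qed


section \<open>The cocycle generated by the equation\<close>

text \<open>The damping coefficient, usually denoted by the letter lambda, is called \<open>\<kappa>\<close> because the
  symbol for lambda is reserved for abstraction.\<close>

definition lattice_solution ::
  "real \<Rightarrow> real \<Rightarrow> (real \<Rightarrow> real) \<Rightarrow> (real \<Rightarrow> ell2) \<Rightarrow> ell2 \<Rightarrow> (real \<Rightarrow> ell2) \<Rightarrow> bool" where
  "lattice_solution \<nu> \<kappa> F g v u \<longleftrightarrow> u 0 = v \<and>
     (\<forall>t\<ge>0. (u has_vector_derivative
        \<nu> *\<^sub>R discrete_laplacian (u t) - \<kappa> *\<^sub>R u t + nemytskii F (u t) + g t) (at t within {0..}))"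

text \<open>\<open>lattice_cocycle \<nu> \<kappa> F t v g\<close>, for \<open>t \<ge> 0\<close>, is the value at time \<open>t\<close> of the unique
  solution on the half-line \<open>{0..}\<close> with forcing \<open>g\<close> and initial value \<open>v\<close>. The values of
  solutions at negative times are irrelevant, so uniqueness is required of the value
  \<open>u t\<close> and not of the total function \<open>u\<close>.\<close>

definition lattice_cocycle ::
  "real \<Rightarrow> real \<Rightarrow> (real \<Rightarrow> real) \<Rightarrow> real \<Rightarrow> ell2 \<Rightarrow> (real \<Rightarrow> ell2) \<Rightarrow> ell2" where
  "lattice_cocycle \<nu> \<kappa> F t v g = (THE x. \<exists>u. lattice_solution \<nu> \<kappa> F g v u \<and> u t = x)"


section \<open>Compact global attractors\<close>

text \<open>The semi-distance takes values in the extended non-negative reals, so that suprema of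
  unbounded sets and infima over the empty set are infinite.\<close>

definition semi_distance :: "'a::metric_space set \<Rightarrow> 'a set \<Rightarrow> ennreal" where
  "semi_distance A B = (SUP a\<in>A. INF b\<in>B. ennreal (dist a b))"

definition compact_global_attractor ::
  "(real \<Rightarrow> 'w::metric_space \<Rightarrow> 'y \<Rightarrow> 'w) \<Rightarrow> 'y set \<Rightarrow> (real \<Rightarrow> 'y \<Rightarrow> 'y) \<Rightarrow> ('y \<Rightarrow> 'w set) \<Rightarrow> bool"
where
  "compact_global_attractor \<phi> Y \<sigma> I \<longleftrightarrow>
     (\<forall>y\<in>Y. compact (I y)) \<and>
     compact (closure (\<Union>y\<in>Y. I y)) \<and>
     (\<forall>t\<ge>0. \<forall>y\<in>Y. (\<lambda>v. \<phi> t v y) ` I y = I (\<sigma> t y)) \<and>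
     (\<forall>M. compact M \<longrightarrow>
        ((\<lambda>t. SUP y\<in>Y. semi_distance ((\<lambda>v. \<phi> t v y) ` M) (\<Union>y\<in>Y. I y)) \<longlongrightarrow> 0) at_top)"

end

theory Submission
  imports Defs
begin

text \<open>The vector field is one-sided Lipschitz with constant \<open>-\<kappa>\<close>, so two solutions with the same
  forcing approach each other exponentially, and a perturbation of the forcing of size \<open>\<epsilon>\<close> costs
  at most \<open>\<epsilon> / \<kappa>\<close>. Starting at \<open>0\<close> at time \<open>-s\<close> and letting \<open>s \<longrightarrow> \<infinity>\<close> therefore yields, for every
  forcing \<open>g\<close>, the value \<open>p g\<close> at time \<open>0\<close> of a bounded complete trajectory which attracts all
  solutions, and \<open>I\<^sub>g = {p g}\<close>. Almost periodicity makes the set of all \<open>p g\<close> totally bounded: up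
  to a small error each of them is \<open>p\<close> of a translate of \<open>f\<close> by an amount in a fixed compact
  interval. Global solutions come from a Picard iteration in a weighted supremum norm after
  truncating \<open>F\<close> outside an interval which the a priori bound shows is never left.\<close>

section \<open>Differential equations in Banach spaces\<close>

lemma integral_has_vector_derivative_Ici:
  fixes h :: "real \<Rightarrow> 'a::banach"
  assumes "continuous_on UNIV h" and "t \<ge> 0"
  shows "((\<lambda>s. integral {0..s} h) has_vector_derivative h t) (at t within {0..})"
proof -
  have "((\<lambda>s. integral {0..s} h) has_vector_derivative h t) (at t within {0..t + 1})"
    by (rule integral_has_vector_derivative)
      (use assms in \<open>auto intro: continuous_on_subset\<close>)
  \<comment> \<open>The right end \<open>t + 1\<close> lies strictly beyond \<open>t\<close>, so the
    interval and the half-line coincide near \<open>t\<close>; at \<open>t = 0\<close> both give the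
    one-sided derivative.\<close>
  moreover have "at t within {0..t + 1} = at t within {0..}"
    by (rule at_within_nhd[of t "{..<t + 1}"]) (use assms in auto)
  ultimately show ?thesis by simp
qed

text \<open>Integrating the exponential bound gains the factor \<open>1 / K\<close>, and the weight
  removes the growth. This gain is what makes the Picard operator a contraction.\<close>

lemma norm_integral_le_exp:
  fixes h :: "real \<Rightarrow> 'a::banach"
  assumes "continuous_on UNIV h" and "K > 0" and "s \<ge> 0"
    and "\<And>r. 0 \<le> r \<Longrightarrow> norm (h r) \<le> B * exp (K * r)"
  shows "exp (- (K * s)) * norm (integral {0..s} h) \<le> B / K"
proof -
  have B: "B \<ge> 0" using assms(4)[of 0] norm_ge_zero[of "h 0"] by (simp del: norm_ge_zero)
  have I: "((\<lambda>r. B * exp (K * r)) has_integral (B / K * exp (K * s) - B / K * exp (K * 0))) {0..s}"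
    by (rule fundamental_theorem_of_calculus)
      (use assms in \<open>auto intro!: derivative_eq_intros simp flip: has_real_derivative_iff_has_vector_derivative\<close>)
  have "norm (integral {0..s} h) \<le> integral {0..s} (\<lambda>r. B * exp (K * r))"
    by (rule integral_norm_bound_integral)
      (use assms in \<open>auto intro!: integrable_continuous_interval continuous_intros intro: continuous_on_subset\<close>)
  also have "\<dots> = B / K * exp (K * s) - B / K"
    using integral_unique[OF I] by simp
  also have "\<dots> \<le> B / K * exp (K * s)" using B assms by simp
  finally have "exp (- (K * s)) * norm (integral {0..s} h) \<le> exp (- (K * s)) * (B / K * exp (K * s))"
    by (rule mult_left_mono) simp
  then show ?thesis by (simp add: exp_minus field_simps)
qed

text \<open>Bielecki's weighted norm: with \<open>u t = exp (K * t) *\<^sub>R w t\<close> and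
  \<open>w\<close> bounded, the integral operator contracts with ratio \<open>L / K < 1\<close>, so
  one fixed point gives the solution on the whole half-line without any continuation
  argument.\<close>

lemma picard_global:
  fixes G :: "'a::banach \<Rightarrow> 'a" and g :: "real \<Rightarrow> 'a"
  assumes G: "L-lipschitz_on UNIV G" and g: "continuous_on UNIV g" "\<And>t. norm (g t) \<le> C"
  shows "\<exists>u. u 0 = v \<and> (\<forall>t\<ge>0. (u has_vector_derivative G (u t) + g t) (at t within {0..}))"
proof -
  define K where "K = L + 1"
  have L: "L \<ge> 0" using G by (rule lipschitz_on_nonneg)
  then have K: "K > 0" by (simp add: K_def)
  \<comment> \<open>In terms of \<open>w\<close>, \<open>h\<close> is the integrand,
    \<open>J\<close> the integral operator and \<open>P\<close> its reweighted form. The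
    \<open>max 0 t\<close> extends \<open>P w\<close> by the constant \<open>v\<close> to negative
    times, as bounded continuous functions live on the whole line.\<close>
  define h where "h w r = G (exp (K * r) *\<^sub>R w r) + g r" for w :: "real \<Rightarrow> 'a" and r
  define J where "J w s = v + integral {0..s} (h w)" for w s
  define P where "P w t = exp (- (K * max 0 t)) *\<^sub>R J w (max 0 t)" for w t
  have hc: "continuous_on UNIV (h w)" if "continuous_on UNIV w" for w
    unfolding h_def
    by (intro continuous_intros that g
        continuous_on_compose2[OF lipschitz_on_continuous_on[OF G]]) auto
  have Jd: "(J w has_vector_derivative h w t) (at t within {0..})"
    if "continuous_on UNIV w" "t \<ge> 0" for w t
    unfolding J_def
    using has_vector_derivative_add[OF has_vector_derivative_const
        integral_has_vector_derivative_Ici[OF hc[OF that(1)] that(2)]]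
    by simp
  \<comment> \<open>A Lipschitz \<open>G\<close> grows at most linearly, so the integrand is at most
    a constant times \<open>exp (K * r)\<close>. Hence \<open>P\<close> maps bounded functions to
    bounded functions.\<close>
  have bound: "exp (- (K * s)) * norm (integral {0..s} (h w)) \<le> (L * norm w + norm (G 0) + C) / K"
    if "s \<ge> 0" for s and w :: "real \<Rightarrow>\<^sub>C 'a"
  proof (rule norm_integral_le_exp[OF hc K that])
    fix r :: real assume r: "0 \<le> r"
    have e: "1 \<le> exp (K * r)" using r K by simp
    have C: "0 \<le> C" using g(2)[of 0] norm_ge_zero order_trans by blast
    have "norm (G (exp (K * r) *\<^sub>R w r)) \<le> norm (G (exp (K * r) *\<^sub>R w r) - G 0) + norm (G 0)"
      by (metis norm_triangle_sub add.commute)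
    also have "norm (G (exp (K * r) *\<^sub>R w r) - G 0) \<le> L * (exp (K * r) * norm (w r))"
      using lipschitz_onD[OF G, of "exp (K * r) *\<^sub>R w r" 0] by (simp add: dist_norm)
    also have "L * (exp (K * r) * norm (w r)) \<le> L * (exp (K * r) * norm w)"
      by (intro mult_left_mono norm_bounded) (use L in auto)
    finally have 1: "norm (G (exp (K * r) *\<^sub>R w r)) \<le> L * (exp (K * r) * norm w) + norm (G 0)" by simp
    have "norm (h w r) \<le> L * (exp (K * r) * norm w) + (norm (G 0) + C)"
      unfolding h_def using 1 g(2)[of r] norm_triangle_ineq[of "G (exp (K * r) *\<^sub>R w r)" "g r"]
      by linarith
    also have "norm (G 0) + C \<le> (norm (G 0) + C) * exp (K * r)"
      using mult_left_mono[OF e, of "norm (G 0) + C"] C by simp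
    finally show "norm (h w r) \<le> (L * norm w + norm (G 0) + C) * exp (K * r)"
      by (simp add: algebra_simps)
  qed (auto intro: continuous_intros)
  have Pb: "P w \<in> bcontfun" for w :: "real \<Rightarrow>\<^sub>C 'a"
    unfolding bcontfun_def
  proof (intro CollectI conjI)
    have "continuous_on {0..} (J w)"
      by (rule continuous_on_vector_derivative[OF Jd]) (auto intro: continuous_intros)
    then have "continuous_on UNIV (\<lambda>t. J w (max 0 t))"
      by (rule continuous_on_compose2) (auto intro!: continuous_intros)
    then show "continuous_on UNIV (P w)"
      unfolding P_def by (intro continuous_intros)
    have "norm (P w t) \<le> norm v + (L * norm w + norm (G 0) + C) / K" for t
    proof -
      let ?s = "max 0 t"
      have "norm (P w t) \<le> exp (- (K * ?s)) * (norm v + norm (integral {0..?s} (h w)))"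
        unfolding P_def J_def by (simp add: norm_triangle_ineq)
      also have "\<dots> = exp (- (K * ?s)) * norm v + exp (- (K * ?s)) * norm (integral {0..?s} (h w))"
        by (simp add: distrib_left)
      also have "exp (- (K * ?s)) * norm v \<le> 1 * norm v"
        by (rule mult_right_mono) (use K in auto)
      finally show ?thesis using bound[of ?s w] by simp
    qed
    then show "bounded (range (P w))" by (auto simp: bounded_iff)
  qed
  define Q where "Q w = Bcontfun (P (apply_bcontfun w))" for w
  have Q: "apply_bcontfun (Q w) = P w" for w
    unfolding Q_def using Pb by (rule Bcontfun_inverse)
  have "\<exists>!w. Q w = w"
  proof (rule banach_fix_type)
    show "0 \<le> L / K" "L / K < 1" using L K by (auto simp: K_def)
    have "dist (Q w1) (Q w2) \<le> L / K * dist w1 w2" for w1 w2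
    proof (rule dist_bound)
      have *: "norm (h w1 r - h w2 r) \<le> L * dist w1 w2 * exp (K * r)" for r
      proof -
        have "norm (h w1 r - h w2 r) \<le> L * (exp (K * r) * dist (w1 r) (w2 r))"
          using lipschitz_onD[OF G, of "exp (K * r) *\<^sub>R w1 r" "exp (K * r) *\<^sub>R w2 r"]
          by (simp add: h_def dist_norm flip: scaleR_diff_right)
        also have "\<dots> \<le> L * (exp (K * r) * dist w1 w2)"
          by (intro mult_left_mono dist_bounded) (use L in auto)
        finally show ?thesis by (simp add: algebra_simps)
      qed
      fix t :: real
      let ?s = "max 0 t"
      have "dist (Q w1 t) (Q w2 t)
          = exp (- (K * ?s)) * norm (integral {0..?s} (h w1) - integral {0..?s} (h w2))"
        unfolding Q P_def J_def by (simp add: dist_norm flip: scaleR_diff_right)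
      also have "integral {0..?s} (h w1) - integral {0..?s} (h w2)
          = integral {0..?s} (\<lambda>r. h w1 r - h w2 r)"
        by (rule integral_diff[symmetric])
          (auto intro!: integrable_continuous_interval continuous_on_subset[OF hc] continuous_intros)
      also have "exp (- (K * ?s)) * norm \<dots> \<le> L * dist w1 w2 / K"
        by (rule norm_integral_le_exp) (use K * in \<open>auto intro!: continuous_intros hc\<close>)
      finally show "dist (Q w1 t) (Q w2 t) \<le> L / K * dist w1 w2" by simp
    qed
    then show "\<forall>w1 w2. dist (Q w1) (Q w2) \<le> L / K * dist w1 w2" by blast
  qed
  then obtain w where w: "Q w = w" by blast
  define u where "u t = exp (K * t) *\<^sub>R w t" for t
  have u: "u t = J w t" if "t \<ge> 0" for t
  proof -
    have "w t = P w t" using Q[of w] w by simp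
    then show ?thesis unfolding u_def using that by (simp add: P_def flip: exp_add)
  qed
  have "(u has_vector_derivative G (u t) + g t) (at t within {0..})" if "t \<ge> 0" for t
  proof (rule has_vector_derivative_transform[of t])
    show "(J w has_vector_derivative G (u t) + g t) (at t within {0..})"
      using Jd[of w t] that by (simp add: h_def u_def continuous_on_apply_bcontfun)
  qed (use u that in auto)
  moreover have "u 0 = v" using u[of 0] by (simp add: J_def)
  ultimately show ?thesis by blast
qed

text \<open>Half of the dissipation \<open>2 * \<kappa>\<close> in the derivative of
  \<open>(norm (d t))\<^sup>2\<close> is spent on absorbing the linear term by completing a square.
  The other half makes \<open>\<psi>\<close> nonincreasing and leaves the rate
  \<open>\<kappa>\<close>.\<close>

lemma dissipative_estimate:
  fixes d :: "real \<Rightarrow> 'a::real_inner"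
  assumes "\<kappa> > 0" and "T \<ge> 0"
    and d: "\<And>t. t \<ge> 0 \<Longrightarrow> (d has_vector_derivative d' t) (at t within {0..})"
    and le: "\<And>t. 0 \<le> t \<Longrightarrow> t \<le> T \<Longrightarrow> d t \<bullet> d' t \<le> - \<kappa> * (norm (d t))\<^sup>2 + \<epsilon> * norm (d t)"
  shows "(norm (d T))\<^sup>2 \<le> exp (- \<kappa> * T) * (norm (d 0))\<^sup>2 + (\<epsilon> / \<kappa>)\<^sup>2"
proof -
  define \<psi> where "\<psi> t = exp (\<kappa> * t) * (d t \<bullet> d t - (\<epsilon> / \<kappa>)\<^sup>2)" for t
  define \<psi>' where "\<psi>' t = \<kappa> * exp (\<kappa> * t) * (d t \<bullet> d t - (\<epsilon> / \<kappa>)\<^sup>2)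
    + exp (\<kappa> * t) * (2 * (d t \<bullet> d' t))" for t
  have D: "(\<psi> has_real_derivative \<psi>' t) (at t within {0..})" if "t \<ge> 0" for t
  proof -
    have "((\<lambda>t. d t \<bullet> d t) has_vector_derivative d t \<bullet> d' t + d' t \<bullet> d t) (at t within {0..})"
      by (rule bounded_bilinear.has_vector_derivative[OF bounded_bilinear_inner d[OF that] d[OF that]])
    then have *: "((\<lambda>t. d t \<bullet> d t) has_real_derivative 2 * (d t \<bullet> d' t)) (at t within {0..})"
      by (simp add: has_real_derivative_iff_has_vector_derivative inner_commute)
    show ?thesis
      unfolding \<psi>_def \<psi>'_def
      by (rule derivative_eq_intros * refl | simp)+
  qed
  have neg: "\<psi>' t \<le> 0" if "0 \<le> t" "t \<le> T" for t
  proof -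
    have "0 \<le> \<kappa> * (norm (d t) - \<epsilon> / \<kappa>)\<^sup>2" using assms(1) by simp
    also have "\<dots> = \<kappa> * (norm (d t))\<^sup>2 - 2 * \<epsilon> * norm (d t) + \<kappa> * (\<epsilon> / \<kappa>)\<^sup>2"
      using assms(1) by (simp add: field_simps power2_eq_square)
    finally have "\<kappa> * (d t \<bullet> d t - (\<epsilon> / \<kappa>)\<^sup>2) + 2 * (d t \<bullet> d' t) \<le> 0"
      using le[OF that] by (simp add: power2_norm_eq_inner algebra_simps)
    then have "exp (\<kappa> * t) * (\<kappa> * (d t \<bullet> d t - (\<epsilon> / \<kappa>)\<^sup>2) + 2 * (d t \<bullet> d' t)) \<le> 0"
      by (simp add: mult_le_0_iff)
    then show ?thesis by (simp add: \<psi>'_def algebra_simps)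
  qed
  have "\<psi> T \<le> \<psi> 0"
  \<comment> \<open>At \<open>0\<close> only a one-sided derivative is given, so the two-sided
    derivative is used on the open interval and continuity covers the endpoints.\<close>
  proof (rule DERIV_nonpos_imp_decreasing_open[OF \<open>T \<ge> 0\<close>])
    show "continuous_on {0..T} \<psi>"
      by (rule continuous_on_subset[OF DERIV_continuous_on[OF D]]) auto
    fix t assume t: "0 < t" "t < T"
    have "at t within {0..} = at t" by (rule at_within_interior) (use t in auto)
    then show "\<exists>y. (\<psi> has_real_derivative y) (at t) \<and> y \<le> 0"
      using D[of t] neg[of t] t by auto
  qed
  then have "exp (- \<kappa> * T) * \<psi> T \<le> exp (- \<kappa> * T) * \<psi> 0" by (intro mult_left_mono) auto
  moreover have "exp (- \<kappa> * T) * \<psi> T = (norm (d T))\<^sup>2 - (\<epsilon> / \<kappa>)\<^sup>2"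
    by (simp add: \<psi>_def power2_norm_eq_inner exp_minus)
  moreover have "exp (- \<kappa> * T) * \<psi> 0 \<le> exp (- \<kappa> * T) * (norm (d 0))\<^sup>2"
    by (intro mult_left_mono) (auto simp: \<psi>_def power2_norm_eq_inner)
  ultimately show ?thesis by linarith
qed

section \<open>Operators on the sequence space\<close>

lemma norm_ell2_le_dominated:
  assumes "\<And>i. \<bar>coord v i\<bar> \<le> c * \<bar>coord u i\<bar>" and "c \<ge> 0"
  shows "norm v \<le> c * norm u"
proof (rule power2_le_imp_le)
  have s: "(\<lambda>i. (coord w i)\<^sup>2) summable_on UNIV" for w
    using square_summable_coord[of w] by (simp add: square_summable_def)
  have "(norm v)\<^sup>2 \<le> (\<Sum>\<^sub>\<infinity>i. c\<^sup>2 * (coord u i)\<^sup>2)"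
    unfolding norm_ell2_power2
  proof (rule infsum_mono)
    show "(coord v i)\<^sup>2 \<le> c\<^sup>2 * (coord u i)\<^sup>2" for i
      using power_mono[OF assms(1)[of i], of 2] by (simp add: power_mult_distrib)
  qed (auto intro: s summable_on_cmult_right)
  also have "\<dots> = (c * norm u)\<^sup>2"
    by (simp add: infsum_cmult_right s norm_ell2_power2 power_mult_distrib)
  finally show "(norm v)\<^sup>2 \<le> (c * norm u)\<^sup>2" .
qed (use assms in simp)

text \<open>The Laplacian is a combination of two shifts and the identity. Shifts are isometries, so
  its norm and sign properties reduce to the triangle and Cauchy-Schwarz inequalities.\<close>

definition shift :: "int \<Rightarrow> ell2 \<Rightarrow> ell2" where
  "shift k u = Abs_ell2 (\<lambda>i. coord u (i + k))"

lemma coord_shift: "coord (shift k u) i = coord u (i + k)"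
  by (simp add: shift_def coord_Abs_ell2 square_summable_shift)

lemma norm_shift: "norm (shift k u) = norm u"
proof -
  have "bij_betw (\<lambda>i::int. i + k) UNIV UNIV"
    by (rule bij_betw_byWitness[where f' = "\<lambda>i. i - k"]) auto
  from infsum_reindex_bij_betw[OF this, of "\<lambda>i. (coord u i)\<^sup>2"]
  have "(norm (shift k u))\<^sup>2 = (norm u)\<^sup>2" by (simp add: norm_ell2_power2 coord_shift)
  then show ?thesis by simp
qed

lemma discrete_laplacian_eq_shift: "discrete_laplacian u = shift (-1) u - 2 *\<^sub>R u + shift 1 u"
  by (rule ell2_eqI) (simp add: coord_discrete_laplacian coord_ell2_simps coord_shift)

lemma discrete_laplacian_diff:
  "discrete_laplacian (u - v) = discrete_laplacian u - discrete_laplacian v"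
  by (rule ell2_eqI) (simp add: coord_discrete_laplacian coord_ell2_simps)

lemma norm_discrete_laplacian_le: "norm (discrete_laplacian u) \<le> 4 * norm u"
proof -
  have "norm (discrete_laplacian u) \<le> norm (shift (-1) u) + norm (2 *\<^sub>R u) + norm (shift 1 u)"
    unfolding discrete_laplacian_eq_shift
    by (meson add_right_mono norm_triangle_ineq norm_triangle_ineq4 order_trans)
  then show ?thesis by (simp add: norm_shift)
qed

text \<open>By Cauchy-Schwarz each shift contributes at most \<open>(norm u)\<^sup>2\<close>, and
  the middle term contributes minus twice that.\<close>

lemma inner_discrete_laplacian_nonpos: "u \<bullet> discrete_laplacian u \<le> 0"
  using norm_cauchy_schwarz[of u "shift (-1) u"] norm_cauchy_schwarz[of u "shift 1 u"]
  by (simp add: discrete_laplacian_eq_shift inner_add_right inner_diff_right norm_shift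
      flip: power2_norm_eq_inner power2_eq_square)

section \<open>The cocycle of the dissipative lattice equation\<close>

text \<open>A translation-invariant class with one common bound. For a suitable \<open>C\<close> it
  contains the whole hull, which makes all estimates below uniform over the hull.\<close>

definition bounded_forcing :: "real \<Rightarrow> (real \<Rightarrow> ell2) set" where
  "bounded_forcing C = {g. continuous_on UNIV g \<and> (\<forall>t. norm (g t) \<le> C)}"

lemma translate_bounded_forcing:
  "g \<in> bounded_forcing C \<Longrightarrow> translate h g \<in> bounded_forcing C"
  unfolding bounded_forcing_def translate_def
  by (auto intro!: continuous_intros continuous_on_compose2[of UNIV g])

lemma translate_translate: "translate h (translate k g) = translate (h + k) g"
  by (simp add: translate_def add.assoc)

lemma translate_0 [simp]: "translate 0 g = g"
  by (simp add: translate_def)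

text \<open>Monotonicity is stated as \<open>antimono F\<close> because this form survives
  truncation of the argument: \<open>solution_exists\<close> interprets the locale again for the
  truncated nonlinearity.\<close>

locale dissipative_lattice =
  fixes \<nu> \<kappa> :: real and F :: "real \<Rightarrow> real"
  assumes nu_pos: "\<nu> > 0" and kappa_pos: "\<kappa> > 0"
    and F_lipschitz: "lipschitz_on_bounded_sets F" and F_0: "F 0 = 0" and F_antimono: "antimono F"
begin

section \<open>One-sided and global Lipschitz bounds for the vector field\<close>

definition field :: "ell2 \<Rightarrow> ell2" where
  "field u = \<nu> *\<^sub>R discrete_laplacian u - \<kappa> *\<^sub>R u + nemytskii F u"

lemma coord_nem: "coord (nemytskii F u) i = F (coord u i)"
  by (rule coord_nemytskii[OF F_lipschitz F_0])

lemma inner_nemytskii_diff_nonpos: "(u - v) \<bullet> (nemytskii F u - nemytskii F v) \<le> 0"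
proof -
  have "(x - y) * (F x - F y) \<le> 0" for x y
    using antimonoD[OF F_antimono, of x y] antimonoD[OF F_antimono, of y x]
    by (cases "x \<le> y") (auto simp: mult_le_0_iff)
  then show ?thesis
    using infsum_nonneg[of UNIV "\<lambda>i. - (coord (u - v) i * coord (nemytskii F u - nemytskii F v) i)"]
    unfolding inner_ell2_def by (simp add: infsum_uminus coord_ell2_simps coord_nem)
qed

text \<open>The damping term alone supplies the right-hand side; the Laplacian and the Nemytskii
  part contribute nonpositive terms.\<close>

lemma inner_field_diff_le: "(u - v) \<bullet> (field u - field v) \<le> - \<kappa> * (norm (u - v))\<^sup>2"
proof -
  have "field u - field v = \<nu> *\<^sub>R discrete_laplacian (u - v) - \<kappa> *\<^sub>R (u - v)
      + (nemytskii F u - nemytskii F v)"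
    by (simp add: field_def discrete_laplacian_diff scaleR_diff_right algebra_simps)
  then have "(u - v) \<bullet> (field u - field v) = \<nu> * ((u - v) \<bullet> discrete_laplacian (u - v))
      - \<kappa> * (norm (u - v))\<^sup>2 + (u - v) \<bullet> (nemytskii F u - nemytskii F v)"
    by (simp add: inner_add_right inner_diff_right power2_norm_eq_inner)
  moreover have "\<nu> * ((u - v) \<bullet> discrete_laplacian (u - v)) \<le> 0"
    using nu_pos inner_discrete_laplacian_nonpos by (simp add: mult_le_0_iff)
  ultimately show ?thesis using inner_nemytskii_diff_nonpos[of u v] by simp
qed

lemma field_lipschitz:
  assumes "L-lipschitz_on UNIV F"
  shows "(\<nu> * 4 + \<kappa> + L)-lipschitz_on UNIV field"
proof (rule lipschitz_onI)
  have L: "L \<ge> 0" using assms by (rule lipschitz_on_nonneg)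
  then show "0 \<le> \<nu> * 4 + \<kappa> + L" using nu_pos kappa_pos by simp
  fix u v
  have "field u - field v = \<nu> *\<^sub>R discrete_laplacian (u - v) - \<kappa> *\<^sub>R (u - v)
      + (nemytskii F u - nemytskii F v)"
    by (simp add: field_def discrete_laplacian_diff scaleR_diff_right algebra_simps)
  then have "norm (field u - field v) \<le> norm (\<nu> *\<^sub>R discrete_laplacian (u - v))
      + norm (\<kappa> *\<^sub>R (u - v)) + norm (nemytskii F u - nemytskii F v)"
    by (metis (no_types, lifting) add_right_mono norm_triangle_ineq norm_triangle_ineq4 order_trans)
  moreover have "norm (\<nu> *\<^sub>R discrete_laplacian (u - v)) \<le> \<nu> * (4 * norm (u - v))"
    using nu_pos norm_discrete_laplacian_le by simp
  moreover have "norm (nemytskii F u - nemytskii F v) \<le> L * norm (u - v)"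
  proof (rule norm_ell2_le_dominated[OF _ L])
    show "\<bar>coord (nemytskii F u - nemytskii F v) i\<bar> \<le> L * \<bar>coord (u - v) i\<bar>" for i
      using lipschitz_onD[OF assms, of "coord u i" "coord v i"]
      by (simp add: coord_ell2_simps coord_nem dist_real_def)
  qed
  ultimately show "dist (field u) (field v) \<le> (\<nu> * 4 + \<kappa> + L) * dist u v"
    using kappa_pos by (simp add: dist_norm distrib_right mult.assoc)
qed

section \<open>A priori estimates and global existence\<close>

lemma lattice_solution_iff: "lattice_solution \<nu> \<kappa> F g v u \<longleftrightarrow> u 0 = v \<and>
    (\<forall>t\<ge>0. (u has_vector_derivative field (u t) + g t) (at t within {0..}))"
  by (simp add: lattice_solution_def field_def)

text \<open>The source of all later estimates: \<open>\<epsilon> = 0\<close> gives uniqueness and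
  contraction, \<open>v = v'\<close> gives dependence on the forcing, and comparison with the zero
  solution gives the a priori bound.\<close>

lemma solution_dist_le:
  assumes u: "lattice_solution \<nu> \<kappa> F g v u" and u': "lattice_solution \<nu> \<kappa> F g' v' u'"
    and "t \<ge> 0" and g: "\<And>s. 0 \<le> s \<Longrightarrow> s \<le> t \<Longrightarrow> norm (g s - g' s) \<le> \<epsilon>"
  shows "(norm (u t - u' t))\<^sup>2 \<le> exp (- \<kappa> * t) * (norm (v - v'))\<^sup>2 + (\<epsilon> / \<kappa>)\<^sup>2"
proof -
  have "(norm (u t - u' t))\<^sup>2 \<le> exp (- \<kappa> * t) * (norm (u 0 - u' 0))\<^sup>2 + (\<epsilon> / \<kappa>)\<^sup>2"
  proof (rule dissipative_estimate[OF kappa_pos \<open>t \<ge> 0\<close>, of "\<lambda>s. u s - u' s"])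
    show "((\<lambda>s. u s - u' s) has_vector_derivative (field (u s) + g s) - (field (u' s) + g' s))
        (at s within {0..})" if "s \<ge> 0" for s
      using u u' that unfolding lattice_solution_iff by (intro has_vector_derivative_diff) auto
    show "(u s - u' s) \<bullet> ((field (u s) + g s) - (field (u' s) + g' s))
        \<le> - \<kappa> * (norm (u s - u' s))\<^sup>2 + \<epsilon> * norm (u s - u' s)" if "0 \<le> s" "s \<le> t" for s
    proof -
      have "(u s - u' s) \<bullet> (g s - g' s) \<le> norm (u s - u' s) * norm (g s - g' s)"
        by (rule norm_cauchy_schwarz)
      also have "\<dots> \<le> norm (u s - u' s) * \<epsilon>" by (intro mult_left_mono g that) simp
      finally have "(u s - u' s) \<bullet> (g s - g' s) \<le> \<epsilon> * norm (u s - u' s)" by (simp add: mult.commute)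
      moreover have "(field (u s) + g s) - (field (u' s) + g' s)
          = (field (u s) - field (u' s)) + (g s - g' s)" by simp
      ultimately show ?thesis
        using inner_field_diff_le[of "u s" "u' s"] by (simp only: inner_add_right)
    qed
  qed
  then show ?thesis using u u' by (simp add: lattice_solution_iff)
qed

lemma solution_0: "lattice_solution \<nu> \<kappa> F (\<lambda>_. 0) 0 (\<lambda>_. 0)"
proof -
  have "nemytskii F 0 = 0" by (rule ell2_eqI) (simp add: coord_nem coord_zero_ell2 F_0)
  moreover have "discrete_laplacian 0 = 0" using discrete_laplacian_diff[of 0 0] by simp
  ultimately show ?thesis by (simp add: lattice_solution_def)
qed

lemma solution_norm_le:
  assumes "lattice_solution \<nu> \<kappa> F g v u" and "g \<in> bounded_forcing C" and "t \<ge> 0"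
  shows "(norm (u t))\<^sup>2 \<le> exp (- \<kappa> * t) * (norm v)\<^sup>2 + (C / \<kappa>)\<^sup>2"
  using solution_dist_le[OF assms(1) solution_0 assms(3), of C] assms(2)
  by (simp add: bounded_forcing_def)

lemma solution_exists:
  assumes g: "g \<in> bounded_forcing C"
  shows "\<exists>u. lattice_solution \<nu> \<kappa> F g v u"
proof -
  \<comment> \<open>This is the bound of \<open>solution_norm_le\<close> at its largest, at time
    \<open>0\<close>. It depends on \<open>v\<close>, \<open>C\<close> and \<open>\<kappa>\<close>
    but not on the nonlinearity, so it can be fixed before truncating and holds for the truncated
    equation.\<close>
  define R where "R = sqrt ((norm v)\<^sup>2 + (C / \<kappa>)\<^sup>2)"
  define clip where "clip x = max (- R) (min R x)" for x :: real
  have R: "R \<ge> 0" by (simp add: R_def)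
  have clip: "\<bar>clip x\<bar> \<le> R" "\<bar>x\<bar> \<le> R \<Longrightarrow> clip x = x" "x \<le> y \<Longrightarrow> clip x \<le> clip y"
    "\<bar>clip x - clip y\<bar> \<le> \<bar>x - y\<bar>" for x y
    using R by (auto simp: clip_def)
  obtain L where L: "L-lipschitz_on (cball 0 R) F"
    using F_lipschitz bounded_cball unfolding lipschitz_on_bounded_sets_def by blast
  have LF: "L-lipschitz_on UNIV (\<lambda>x. F (clip x))"
  proof (rule lipschitz_onI)
    show L0: "0 \<le> L" using L by (rule lipschitz_on_nonneg)
    fix x y
    have "dist (F (clip x)) (F (clip y)) \<le> L * dist (clip x) (clip y)"
      by (rule lipschitz_onD[OF L]) (use clip in auto)
    also have "\<dots> \<le> L * dist x y"
      using clip(4)[of x y] L0 by (intro mult_left_mono) (auto simp: dist_real_def)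
    finally show "dist (F (clip x)) (F (clip y)) \<le> L * dist x y" .
  qed
  interpret trunc: dissipative_lattice \<nu> \<kappa> "\<lambda>x. F (clip x)"
  proof
    show "lipschitz_on_bounded_sets (\<lambda>x. F (clip x))"
      unfolding lipschitz_on_bounded_sets_def using lipschitz_on_subset[OF LF] by blast
    show "F (clip 0) = 0" using clip(2)[of 0] R F_0 by simp
    show "antimono (\<lambda>x. F (clip x))"
      using F_antimono clip(3) by (auto simp: antimono_def)
  qed (use nu_pos kappa_pos in auto)
  obtain u where u: "u 0 = v"
    "\<And>t. t \<ge> 0 \<Longrightarrow> (u has_vector_derivative trunc.field (u t) + g t) (at t within {0..})"
    using picard_global[OF trunc.field_lipschitz[OF LF], of g C v] g
    unfolding bounded_forcing_def by blast
  then have sol: "lattice_solution \<nu> \<kappa> (\<lambda>x. F (clip x)) g v u"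
    by (simp add: trunc.lattice_solution_iff)
  \<comment> \<open>Coordinates are bounded by the norm, hence by \<open>R\<close>, and there
    \<open>clip\<close> is the identity. So the truncated solution solves the original
    equation.\<close>
  have "trunc.field (u t) = field (u t)" if "t \<ge> 0" for t
  proof -
    have "(norm (u t))\<^sup>2 \<le> exp (- \<kappa> * t) * (norm v)\<^sup>2 + (C / \<kappa>)\<^sup>2"
      by (rule trunc.solution_norm_le[OF sol g that])
    also have "\<dots> \<le> 1 * (norm v)\<^sup>2 + (C / \<kappa>)\<^sup>2"
      using that kappa_pos by (intro add_right_mono mult_right_mono) auto
    finally have "norm (u t) \<le> R" unfolding R_def by (intro real_le_rsqrt) simp
    then have "\<bar>coord (u t) i\<bar> \<le> R" for i using abs_coord_le_norm order_trans by blast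
    then have "nemytskii (\<lambda>x. F (clip x)) (u t) = nemytskii F (u t)"
      by (intro ell2_eqI) (simp add: coord_nem trunc.coord_nem clip)
    then show ?thesis by (simp add: field_def trunc.field_def)
  qed
  then have "lattice_solution \<nu> \<kappa> F g v u" using u by (simp add: lattice_solution_iff)
  then show ?thesis by blast
qed

section \<open>Contraction, dependence on the forcing, and the cocycle identity\<close>

abbreviation \<phi> :: "real \<Rightarrow> ell2 \<Rightarrow> (real \<Rightarrow> ell2) \<Rightarrow> ell2" where
  "\<phi> \<equiv> lattice_cocycle \<nu> \<kappa> F"

lemma cocycle_eqI:
  assumes "lattice_solution \<nu> \<kappa> F g v u" and "t \<ge> 0"
  shows "\<phi> t v g = u t"
  unfolding lattice_cocycle_def
proof (rule the_equality)
  fix x assume "\<exists>u'. lattice_solution \<nu> \<kappa> F g v u' \<and> u' t = x"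
  then obtain u' where "lattice_solution \<nu> \<kappa> F g v u'" "u' t = x" by blast
  then show "x = u t" using solution_dist_le[OF _ assms, of g v u' 0] by simp
qed (use assms in blast)

lemma cocycle_solution:
  assumes "g \<in> bounded_forcing C"
  shows "lattice_solution \<nu> \<kappa> F g v (\<lambda>t. \<phi> t v g)"
proof -
  obtain u where u: "lattice_solution \<nu> \<kappa> F g v u" using solution_exists[OF assms] by blast
  have "((\<lambda>t. \<phi> t v g) has_vector_derivative field (\<phi> t v g) + g t) (at t within {0..})"
    if "t \<ge> 0" for t
  proof (rule has_vector_derivative_transform[of t])
    show "(u has_vector_derivative field (\<phi> t v g) + g t) (at t within {0..})"
      using u that cocycle_eqI[OF u that] by (simp add: lattice_solution_iff)
  qed (use that cocycle_eqI[OF u] in auto)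
  moreover have "\<phi> 0 v g = v" using cocycle_eqI[OF u, of 0] u by (simp add: lattice_solution_iff)
  ultimately show ?thesis by (simp add: lattice_solution_iff)
qed

text \<open>\<open>solution_dist_le\<close> bounds the squared distance; the square root halves the
  exponent.\<close>

lemma cocycle_contraction:
  assumes "g \<in> bounded_forcing C" and "t \<ge> 0"
  shows "norm (\<phi> t v g - \<phi> t v' g) \<le> exp (- \<kappa> * t / 2) * norm (v - v')"
proof (rule power2_le_imp_le)
  have "(exp (- \<kappa> * t / 2))\<^sup>2 = exp (- \<kappa> * t)" by (simp flip: exp_double)
  then show "(norm (\<phi> t v g - \<phi> t v' g))\<^sup>2 \<le> (exp (- \<kappa> * t / 2) * norm (v - v'))\<^sup>2"
    using solution_dist_le[OF cocycle_solution[OF assms(1)] cocycle_solution[OF assms(1)] assms(2),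
        of 0 v v']
    by (simp add: power_mult_distrib)
qed simp

lemma cocycle_forcing_dist:
  assumes "g \<in> bounded_forcing C" "g' \<in> bounded_forcing C'" and "t \<ge> 0" and "\<epsilon> \<ge> 0"
    and "\<And>s. 0 \<le> s \<Longrightarrow> s \<le> t \<Longrightarrow> norm (g s - g' s) \<le> \<epsilon>"
  shows "norm (\<phi> t v g - \<phi> t v g') \<le> \<epsilon> / \<kappa>"
proof (rule power2_le_imp_le)
  show "(norm (\<phi> t v g - \<phi> t v g'))\<^sup>2 \<le> (\<epsilon> / \<kappa>)\<^sup>2"
    using solution_dist_le[OF cocycle_solution[OF assms(1)] cocycle_solution[OF assms(2)] assms(3),
        of \<epsilon> v v] assms(5)
    by simp
qed (use assms(4) kappa_pos in simp)

lemma norm_cocycle_0_le: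
  assumes "g \<in> bounded_forcing C" and "t \<ge> 0"
  shows "norm (\<phi> t 0 g) \<le> C / \<kappa>"
proof (rule power2_le_imp_le)
  show "(norm (\<phi> t 0 g))\<^sup>2 \<le> (C / \<kappa>)\<^sup>2"
    using solution_norm_le[OF cocycle_solution[OF assms(1)] assms, of 0] by simp
  have "0 \<le> C" using assms(1) norm_ge_zero order_trans unfolding bounded_forcing_def by blast
  then show "0 \<le> C / \<kappa>" using kappa_pos by simp
qed

text \<open>The trajectory shifted in time solves the equation with translated forcing, so
  uniqueness identifies it.\<close>

lemma cocycle_add:
  assumes "g \<in> bounded_forcing C" and "t \<ge> 0" and "\<tau> \<ge> 0"
  shows "\<phi> (t + \<tau>) v g = \<phi> t (\<phi> \<tau> v g) (translate \<tau> g)"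
proof (rule cocycle_eqI[symmetric, OF _ assms(2)])
  have "((\<lambda>s. \<phi> (s + \<tau>) v g) has_vector_derivative field (\<phi> (s + \<tau>) v g) + translate \<tau> g s)
      (at s within {0..})" if "s \<ge> 0" for s
  proof -
    have "((\<lambda>s. \<phi> s v g) has_vector_derivative field (\<phi> (s + \<tau>) v g) + translate \<tau> g s)
        (at (s + \<tau>) within {0..})"
      using cocycle_solution[OF assms(1), of v] that assms(3)
      by (simp add: lattice_solution_iff translate_def)
    \<comment> \<open>The derivative is restricted to the image of the half-line under the time
      shift, as the one-sided chain rule requires.\<close>
    then have "((\<lambda>s. \<phi> s v g) has_vector_derivative field (\<phi> (s + \<tau>) v g) + translate \<tau> g s)
        (at (s + \<tau>) within (\<lambda>s. s + \<tau>) ` {0..})"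
      by (rule has_vector_derivative_within_subset) (use assms(3) in auto)
    then have "((\<lambda>s. \<phi> s v g) \<circ> (\<lambda>s. s + \<tau>) has_vector_derivative
        1 *\<^sub>R (field (\<phi> (s + \<tau>) v g) + translate \<tau> g s)) (at s within {0..})"
      by (intro vector_diff_chain_within) (auto intro!: derivative_eq_intros)
    then show ?thesis by (simp add: o_def)
  qed
  then show "lattice_solution \<nu> \<kappa> F (translate \<tau> g) (\<phi> \<tau> v g) (\<lambda>s. \<phi> (s + \<tau>) v g)"
    by (simp add: lattice_solution_iff)
qed

section \<open>The attracting complete trajectory\<close>

text \<open>The state at time \<open>0\<close> of the solution under \<open>g\<close> that starts at
  \<open>0\<close> at time \<open>- s\<close>. The cocycle always starts its clock at
  \<open>0\<close>, hence the translated forcing.\<close>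

definition pullback :: "real \<Rightarrow> (real \<Rightarrow> ell2) \<Rightarrow> ell2" where
  "pullback s g = \<phi> s 0 (translate (- s) g)"

definition p :: "(real \<Rightarrow> ell2) \<Rightarrow> ell2" where
  "p g = lim (\<lambda>n. pullback (real n) g)"

text \<open>A start at time \<open>- r\<close> reaches some point of norm at most
  \<open>C / \<kappa>\<close> at time \<open>- s\<close>, where the other solution starts from
  \<open>0\<close>. Both then share the forcing for time \<open>s\<close> and contract.\<close>

lemma pullback_dist:
  assumes "g \<in> bounded_forcing C" and "0 \<le> s" and "s \<le> r"
  shows "norm (pullback r g - pullback s g) \<le> exp (- \<kappa> * s / 2) * (C / \<kappa>)"
proof -
  have "pullback r g = \<phi> s (\<phi> (r - s) 0 (translate (- r) g)) (translate (- s) g)"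
    using cocycle_add[OF translate_bounded_forcing[OF assms(1)], of s "r - s" 0 "- r"] assms
    by (simp add: pullback_def translate_translate)
  then have "norm (pullback r g - pullback s g)
      \<le> exp (- \<kappa> * s / 2) * norm (\<phi> (r - s) 0 (translate (- r) g) - 0)"
    unfolding pullback_def
    using cocycle_contraction[OF translate_bounded_forcing[OF assms(1)] assms(2)] by metis
  also have "\<dots> \<le> exp (- \<kappa> * s / 2) * (C / \<kappa>)"
    using norm_cocycle_0_le[OF translate_bounded_forcing[OF assms(1)], of "r - s"] assms
    by (intro mult_left_mono) auto
  finally show ?thesis .
qed

lemma exp_decay: "((\<lambda>t. exp (- \<kappa> * t / 2) * c) \<longlongrightarrow> 0) at_top"
proof -
  have "filterlim (\<lambda>t. \<kappa> / 2 * t) at_top at_top"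
    by (rule filterlim_tendsto_pos_mult_at_top[OF tendsto_const]) (use kappa_pos filterlim_ident in auto)
  then have "((\<lambda>t. exp (- (\<kappa> / 2 * t)) * c) \<longlongrightarrow> 0 * c) at_top"
    by (intro tendsto_intros filterlim_compose[OF exp_at_bot] filterlim_compose[OF filterlim_uminus_at_bot_at_top])
  then show ?thesis by simp
qed

lemma pullback_tendsto:
  assumes g: "g \<in> bounded_forcing C"
  shows "(\<lambda>n. pullback (real n) g) \<longlonglongrightarrow> p g"
proof -
  have "Cauchy (\<lambda>n. pullback (real n) g)"
  proof (rule metric_CauchyI)
    fix e :: real assume "0 < e"
    then have "\<forall>\<^sub>F n in sequentially. exp (- \<kappa> * real n / 2) * (C / \<kappa>) < e / 2"
      by (intro order_tendstoD(2)[OF filterlim_compose[OF exp_decay filterlim_real_sequentially]]) simp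
    then obtain N where N: "exp (- \<kappa> * real N / 2) * (C / \<kappa>) < e / 2"
      by (auto simp: eventually_sequentially)
    have *: "dist (pullback (real n) g) (pullback (real N) g) < e / 2" if "n \<ge> N" for n
      unfolding dist_norm by (rule le_less_trans[OF pullback_dist[OF g] N]) (use that in auto)
    show "\<exists>M. \<forall>m\<ge>M. \<forall>n\<ge>M. dist (pullback (real m) g) (pullback (real n) g) < e"
      using * dist_triangle_half_l by blast
  qed
  then show ?thesis
    unfolding p_def by (simp add: Cauchy_convergent_iff convergent_LIMSEQ_iff)
qed

lemma p_dist_pullback:
  assumes g: "g \<in> bounded_forcing C" and "s \<ge> 0"
  shows "norm (p g - pullback s g) \<le> exp (- \<kappa> * s / 2) * (C / \<kappa>)"
\<comment> \<open>The limit is taken in the larger time of \<open>pullback_dist\<close>, whose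
  condition \<open>s \<le> r\<close> holds from the index \<open>nat \<lceil>s\<rceil>\<close>
  on.\<close>
proof (rule Lim_bounded[of "\<lambda>n. norm (pullback (real n) g - pullback s g)" _ "nat \<lceil>s\<rceil>"])
  show "(\<lambda>n. norm (pullback (real n) g - pullback s g)) \<longlonglongrightarrow> norm (p g - pullback s g)"
    by (intro tendsto_intros pullback_tendsto[OF g])
  show "\<forall>n\<ge>nat \<lceil>s\<rceil>. norm (pullback (real n) g - pullback s g) \<le> exp (- \<kappa> * s / 2) * (C / \<kappa>)"
    using pullback_dist[OF g \<open>s \<ge> 0\<close>] by (simp add: nat_le_iff ceiling_le_iff)
qed

lemma norm_p_le:
  assumes g: "g \<in> bounded_forcing C"
  shows "norm (p g) \<le> C / \<kappa>"
proof (rule Lim_bounded[OF tendsto_norm[OF pullback_tendsto[OF g]]])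
  show "\<forall>n\<ge>0. norm (pullback (real n) g) \<le> C / \<kappa>"
    using norm_cocycle_0_le[OF translate_bounded_forcing[OF g]] by (simp add: pullback_def)
qed

text \<open>Both sides are limits of one sequence: running \<open>pullback (real n) g\<close> for
  time \<open>t\<close> yields the pullback from depth \<open>t + real n\<close> for the translated
  forcing. This depth need not be an integer, so the rate in \<open>p_dist_pullback\<close> for real
  times is used.\<close>

lemma cocycle_p:
  assumes g: "g \<in> bounded_forcing C" and t: "t \<ge> 0"
  shows "\<phi> t (p g) g = p (translate t g)"
proof (rule LIMSEQ_unique)
  have "(\<lambda>n. \<phi> t (pullback (real n) g) g - \<phi> t (p g) g) \<longlonglongrightarrow> 0"
  proof (rule Lim_null_comparison)
    show "\<forall>\<^sub>F n in sequentially. norm (\<phi> t (pullback (real n) g) g - \<phi> t (p g) g)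
        \<le> exp (- \<kappa> * t / 2) * norm (pullback (real n) g - p g)"
      by (intro always_eventually allI cocycle_contraction[OF g t])
    show "(\<lambda>n. exp (- \<kappa> * t / 2) * norm (pullback (real n) g - p g)) \<longlonglongrightarrow> 0"
      using pullback_tendsto[OF g] by (intro tendsto_mult_right_zero tendsto_norm_zero LIM_zero)
  qed
  then show "(\<lambda>n. \<phi> t (pullback (real n) g) g) \<longlonglongrightarrow> \<phi> t (p g) g" by (rule LIM_zero_cancel)
  have eq: "\<phi> t (pullback (real n) g) g = pullback (t + real n) (translate t g)" for n
    using cocycle_add[OF translate_bounded_forcing[OF g] t, of "real n" 0 "- real n"]
    by (simp add: pullback_def translate_translate)
  have "(\<lambda>n. pullback (t + real n) (translate t g) - p (translate t g)) \<longlonglongrightarrow> 0"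
  proof (rule Lim_null_comparison)
    show "\<forall>\<^sub>F n in sequentially. norm (pullback (t + real n) (translate t g) - p (translate t g))
        \<le> exp (- \<kappa> * (t + real n) / 2) * (C / \<kappa>)"
      using p_dist_pullback[OF translate_bounded_forcing[OF g]] t
      by (intro always_eventually allI) (simp add: norm_minus_commute)
    show "(\<lambda>n. exp (- \<kappa> * (t + real n) / 2) * (C / \<kappa>)) \<longlonglongrightarrow> 0"
      by (rule filterlim_compose[OF exp_decay])
        (intro filterlim_tendsto_add_at_top[OF tendsto_const] filterlim_real_sequentially)
  qed
  then show "(\<lambda>n. \<phi> t (pullback (real n) g) g) \<longlonglongrightarrow> p (translate t g)"
    unfolding eq by (rule LIM_zero_cancel)
qed

text \<open>Fading memory: the forcing before time \<open>- s\<close> has exponentially small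
  influence on \<open>p\<close>, and a difference of \<open>\<epsilon>\<close> on the remaining
  window costs \<open>\<epsilon> / \<kappa>\<close>.\<close>

lemma p_dist_le:
  assumes g: "g \<in> bounded_forcing C" and g': "g' \<in> bounded_forcing C" and "s \<ge> 0" and "\<epsilon> \<ge> 0"
    and "\<And>r. - s \<le> r \<Longrightarrow> r \<le> 0 \<Longrightarrow> norm (g r - g' r) \<le> \<epsilon>"
  shows "norm (p g - p g') \<le> 2 * (exp (- \<kappa> * s / 2) * (C / \<kappa>)) + \<epsilon> / \<kappa>"
proof -
  have *: "norm (pullback s g - pullback s g') \<le> \<epsilon> / \<kappa>"
    unfolding pullback_def
    by (rule cocycle_forcing_dist[OF translate_bounded_forcing[OF g] translate_bounded_forcing[OF g']])
      (use assms in \<open>auto simp: translate_def\<close>)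
  have "p g - p g' = (p g - pullback s g) + (pullback s g - pullback s g')
      - (p g' - pullback s g')" by simp
  then have "norm (p g - p g') \<le> norm (p g - pullback s g) + norm (pullback s g - pullback s g')
      + norm (p g' - pullback s g')"
    by (metis (no_types, lifting) add_right_mono norm_triangle_ineq norm_triangle_ineq4 order_trans)
  also have "\<dots> \<le> exp (- \<kappa> * s / 2) * (C / \<kappa>) + \<epsilon> / \<kappa> + exp (- \<kappa> * s / 2) * (C / \<kappa>)"
    by (intro add_mono p_dist_pullback[OF g \<open>s \<ge> 0\<close>] p_dist_pullback[OF g' \<open>s \<ge> 0\<close>] *)
  finally show ?thesis by (simp only: mult_2 add_ac)
qed

text \<open>By \<open>cocycle_p\<close> this curve is the trajectory through \<open>p g\<close>,
  which is differentiable.\<close>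

lemma continuous_on_p_translate:
  assumes "g \<in> bounded_forcing C"
  shows "continuous_on {0..} (\<lambda>t. p (translate t g))"
proof -
  have "continuous_on {0..} (\<lambda>t. \<phi> t (p g) g)"
    using cocycle_solution[OF assms, of "p g"]
    by (intro continuous_on_vector_derivative) (auto simp: lattice_solution_iff)
  then show ?thesis
    by (rule continuous_on_eq) (simp add: cocycle_p[OF assms])
qed

end

section \<open>Hulls of almost periodic functions\<close>

lemma translate_translation_hull:
  assumes "continuous_on UNIV f" and g: "g \<in> translation_hull f"
  shows "translate \<tau> g \<in> translation_hull f"
  unfolding translation_hull_iff[OF assms(1)]
proof (intro conjI allI impI)
  note G = g[unfolded translation_hull_iff[OF assms(1)]]
  show "continuous_on UNIV (translate \<tau> g)"
    unfolding translate_def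
    by (rule continuous_on_compose2[of UNIV g]) (use G in \<open>auto intro!: continuous_intros\<close>)
  fix a b \<epsilon> :: real assume "\<epsilon> > 0"
  then obtain h where h: "\<forall>t\<in>{a + \<tau>..b + \<tau>}. dist (f (t + h)) (g t) < \<epsilon>" using G by blast
  have "dist (f (t + (\<tau> + h))) (translate \<tau> g t) < \<epsilon>" if "t \<in> {a..b}" for t
    using bspec[OF h, of "t + \<tau>"] that by (simp add: translate_def add.assoc)
  then show "\<exists>h. \<forall>t\<in>{a..b}. dist (f (t + h)) (translate \<tau> g t) < \<epsilon>" by blast
qed

text \<open>An almost period for tolerance \<open>1\<close> moves any time into the compact interval
  \<open>{0..l}\<close>, where continuity bounds \<open>f\<close>.\<close>

lemma almost_periodic_bounded:
  assumes "almost_periodic f"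
  shows "bounded (range f)"
proof -
  have c: "continuous_on UNIV f" using assms by (simp add: almost_periodic_def)
  obtain l where l: "\<And>a. {\<tau>. \<forall>t. norm (f (t + \<tau>) - f t) < 1} \<inter> {a..a + l} \<noteq> {}"
    using assms zero_less_one unfolding almost_periodic_def relatively_dense_def by blast
  have "bounded (f ` {0..l})"
    by (intro compact_imp_bounded compact_continuous_image continuous_on_subset[OF c]) auto
  then obtain B where B: "\<And>t. t \<in> {0..l} \<Longrightarrow> norm (f t) \<le> B" unfolding bounded_iff by blast
  have "norm (f t) \<le> B + 1" for t
  proof -
    obtain \<tau> where \<tau>: "norm (f (t + \<tau>) - f t) < 1" "\<tau> \<in> {- t..- t + l}" using l[of "- t"] by blast
    have "norm (f t) \<le> norm (f (t + \<tau>)) + norm (f (t + \<tau>) - f t)"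
      by (metis norm_minus_commute norm_triangle_sub)
    then show ?thesis using B[of "t + \<tau>"] \<tau> by auto
  qed
  then show ?thesis by (auto simp: bounded_iff)
qed

lemma translation_hull_bounded_forcing:
  assumes "almost_periodic f"
  shows "\<exists>C. translation_hull f \<subseteq> bounded_forcing C"
proof -
  have c: "continuous_on UNIV f" using assms by (simp add: almost_periodic_def)
  obtain B where B: "\<And>t. norm (f t) \<le> B"
    using almost_periodic_bounded[OF assms] by (auto simp: bounded_iff)
  have "norm (g t) \<le> B + 1" if "g \<in> translation_hull f" for g t
  proof -
    have "\<exists>h. \<forall>s\<in>{t..t}. dist (f (s + h)) (g s) < 1"
      using that zero_less_one unfolding translation_hull_iff[OF c] by blast
    then obtain h where "dist (f (t + h)) (g t) < 1" by auto
    moreover have "norm (g t) \<le> norm (f (t + h)) + norm (f (t + h) - g t)"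
      by (metis norm_minus_commute norm_triangle_sub)
    ultimately show ?thesis using B[of "t + h"] by (simp add: dist_norm)
  qed
  then show ?thesis
    unfolding bounded_forcing_def using translation_hull_iff[OF c] by blast
qed

text \<open>If the translate of \<open>f\<close> by \<open>k\<close> is close to \<open>g\<close>,
  adding an almost period from \<open>{- k..- k + l}\<close> brings the shift into
  \<open>{0..l}\<close>. The length \<open>l\<close> depends on \<open>\<epsilon>\<close> only, not
  on \<open>g\<close> or the interval.\<close>

lemma almost_periodic_hull_approx:
  assumes "almost_periodic f" and "\<epsilon> > 0"
  shows "\<exists>l. \<forall>g\<in>translation_hull f. \<forall>a b. \<exists>h\<in>{0..l}. \<forall>t\<in>{a..b}. dist (g t) (f (t + h)) < \<epsilon>"
proof -
  have c: "continuous_on UNIV f" using assms by (simp add: almost_periodic_def)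
  have "relatively_dense {\<tau>. \<forall>t. norm (f (t + \<tau>) - f t) < \<epsilon> / 2}"
    using assms unfolding almost_periodic_def by (meson half_gt_zero)
  then obtain l where l: "\<And>a. {\<tau>. \<forall>t. norm (f (t + \<tau>) - f t) < \<epsilon> / 2} \<inter> {a..a + l} \<noteq> {}"
    unfolding relatively_dense_def by blast
  have "\<exists>h\<in>{0..l}. \<forall>t\<in>{a..b}. dist (g t) (f (t + h)) < \<epsilon>" if g: "g \<in> translation_hull f" for g a b
  proof -
    obtain k where k: "\<forall>t\<in>{a..b}. dist (f (t + k)) (g t) < \<epsilon> / 2"
      using g \<open>\<epsilon> > 0\<close> unfolding translation_hull_iff[OF c] by (meson half_gt_zero)
    obtain \<tau> where \<tau>: "\<And>t. norm (f (t + \<tau>) - f t) < \<epsilon> / 2" "\<tau> \<in> {- k..- k + l}"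
      using l[of "- k"] by blast
    have "dist (g t) (f (t + (k + \<tau>))) < \<epsilon>" if "t \<in> {a..b}" for t
      using dist_triangle_half_r[of "f (t + k)" "g t" \<epsilon> "f (t + k + \<tau>)"] k that \<tau>(1)[of "t + k"]
      by (simp add: dist_norm norm_minus_commute add.assoc)
    then show ?thesis using \<tau>(2) by (intro bexI[of _ "k + \<tau>"]) auto
  qed
  then show ?thesis by blast
qed

section \<open>The attractor\<close>

text \<open>A finite net of \<open>K\<close> with radius \<open>e / 3\<close> serves as a net of
  radius \<open>e\<close> for the closure: a third each for passing from the closure to
  \<open>S\<close>, from \<open>S\<close> to \<open>K\<close>, and from \<open>K\<close> to the
  net.\<close>

lemma compact_closure_if_near_compact:
  fixes S :: "'a::complete_space set"
  assumes "\<And>e. e > 0 \<Longrightarrow> \<exists>K. compact K \<and> (\<forall>x\<in>S. \<exists>y\<in>K. dist x y < e)"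
  shows "compact (closure S)"
  unfolding compact_eq_totally_bounded
proof (intro conjI allI impI)
  show "complete (closure S)" by (simp add: complete_eq_closed)
  fix e :: real assume "e > 0"
  then obtain K where K: "compact K" "\<And>x. x \<in> S \<Longrightarrow> \<exists>y\<in>K. dist x y < e / 3"
    using assms[of "e / 3"] by auto
  obtain k where k: "finite k" "K \<subseteq> (\<Union>x\<in>k. ball x (e / 3))"
    using K(1) \<open>e > 0\<close> unfolding compact_eq_totally_bounded by (meson zero_less_divide_iff zero_less_numeral)
  have "\<exists>z\<in>k. dist z x < e" if x: "x \<in> closure S" for x
  proof -
    obtain x' where x': "x' \<in> S" "dist x' x < e / 3"
      using x \<open>e > 0\<close> unfolding closure_approachable by (metis divide_pos_pos zero_less_numeral)
    obtain y where y: "y \<in> K" "dist x' y < e / 3" using K(2) x' by blast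
    obtain z where z: "z \<in> k" "dist z y < e / 3" using k(2) y(1) by auto
    have "dist z x \<le> dist z y + dist x' y + dist x' x"
      by (metis add.assoc add_left_mono dist_commute dist_triangle dist_triangle2 order_trans)
    then show ?thesis using x' y z by (intro bexI[of _ z]) auto
  qed
  then show "\<exists>k. finite k \<and> closure S \<subseteq> (\<Union>x\<in>k. ball x e)"
    using k(1) by (intro exI[of _ k]) (auto simp: subset_iff)
qed

context dissipative_lattice
begin

lemma compact_closure_p_hull:
  assumes "almost_periodic f"
  shows "compact (closure (p ` translation_hull f))"
proof (rule compact_closure_if_near_compact)
  have c: "continuous_on UNIV f" using assms by (simp add: almost_periodic_def)
  obtain C where C: "translation_hull f \<subseteq> bounded_forcing C"
    using translation_hull_bounded_forcing[OF assms] by blast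
  have "f \<in> translation_hull f"
    unfolding translation_hull_iff[OF c] using c by (auto intro!: exI[of _ "0::real"])
  then have f: "f \<in> bounded_forcing C" using C by blast
  fix e :: real assume "e > 0"
  \<comment> \<open>Chosen so that the two terms of \<open>p_dist_le\<close> add up to
    \<open>e\<close>: the forcing error gives \<open>\<epsilon> / \<kappa> = e / 2\<close>, and
    \<open>s\<close> is taken so large that the memory term stays below
    \<open>2 * (e / 4)\<close>.\<close>
  define \<epsilon> where "\<epsilon> = e * \<kappa> / 2"
  have \<epsilon>: "\<epsilon> > 0" using \<open>e > 0\<close> kappa_pos by (simp add: \<epsilon>_def)
  obtain l where l: "\<And>g a b. g \<in> translation_hull f \<Longrightarrow> \<exists>h\<in>{0..l}. \<forall>t\<in>{a..b}. dist (g t) (f (t + h)) < \<epsilon>"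
    using almost_periodic_hull_approx[OF assms \<epsilon>] by blast
  have "\<forall>\<^sub>F s in at_top. exp (- \<kappa> * s / 2) * (C / \<kappa>) < e / 4"
    by (rule order_tendstoD(2)[OF exp_decay]) (use \<open>e > 0\<close> in simp)
  then have "\<forall>\<^sub>F s in at_top. exp (- \<kappa> * s / 2) * (C / \<kappa>) < e / 4 \<and> s \<ge> 0"
    by (intro eventually_conj eventually_ge_at_top)
  then obtain s where s: "exp (- \<kappa> * s / 2) * (C / \<kappa>) < e / 4" "s \<ge> 0"
    using eventually_happens trivial_limit_at_top_linorder by blast
  have "\<exists>y\<in>(\<lambda>h. p (translate h f)) ` {0..l}. dist (p g) y < e" if g: "g \<in> translation_hull f" for g
  proof -
    \<comment> \<open>Only the window \<open>{- s..0}\<close> enters \<open>p_dist_le\<close>, and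
      the shift \<open>h\<close> comes from an interval independent of \<open>g\<close>. So the
      compact arc of all \<open>p (translate h f)\<close> with \<open>h\<close> in
      \<open>{0..l}\<close> serves every \<open>g\<close>.\<close>
    obtain h where h: "h \<in> {0..l}" "\<And>t. t \<in> {- s..0} \<Longrightarrow> dist (g t) (f (t + h)) < \<epsilon>"
      using l[OF g, of "- s" 0] by blast
    have "norm (p g - p (translate h f)) \<le> 2 * (exp (- \<kappa> * s / 2) * (C / \<kappa>)) + \<epsilon> / \<kappa>"
      by (rule p_dist_le[OF _ translate_bounded_forcing[OF f] s(2)])
        (use g C \<epsilon> h(2) in \<open>auto simp: translate_def dist_norm less_imp_le\<close>)
    also have "\<epsilon> / \<kappa> = e / 2" using kappa_pos by (simp add: \<epsilon>_def)
    also have "2 * (exp (- \<kappa> * s / 2) * (C / \<kappa>)) + e / 2 < 2 * (e / 4) + e / 2"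
      by (intro add_strict_right_mono mult_strict_left_mono s) simp
    also have "\<dots> = e" by simp
    finally show ?thesis using h(1) by (auto simp: dist_norm)
  qed
  moreover have "compact ((\<lambda>h. p (translate h f)) ` {0..l})"
    by (intro compact_continuous_image continuous_on_subset[OF continuous_on_p_translate[OF f]]) auto
  ultimately show "\<exists>K. compact K \<and> (\<forall>x\<in>p ` translation_hull f. \<exists>y\<in>K. dist x y < e)" by blast
qed

text \<open>At time \<open>t\<close> a solution under \<open>g\<close> is compared with
  \<open>p (translate t g)\<close>, which belongs to the union because the hull is
  translation-invariant. Their initial distance is at most \<open>R + C / \<kappa>\<close> for every
  \<open>g\<close>, so contraction gives a uniform rate.\<close>

lemma p_hull_attracts:
  assumes "almost_periodic f" and "compact M"
  shows "((\<lambda>t. SUP g\<in>translation_hull f. semi_distance ((\<lambda>v. \<phi> t v g) ` M) (p ` translation_hull f))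
    \<longlongrightarrow> 0) at_top"
proof -
  have c: "continuous_on UNIV f" using assms by (simp add: almost_periodic_def)
  obtain C where C: "translation_hull f \<subseteq> bounded_forcing C"
    using translation_hull_bounded_forcing[OF assms(1)] by blast
  obtain R where R: "\<And>v. v \<in> M \<Longrightarrow> norm v \<le> R"
    using compact_imp_bounded[OF assms(2)] by (auto simp: bounded_iff)
  define D where "D t = ennreal (exp (- \<kappa> * t / 2) * (R + C / \<kappa>))" for t
  have le: "(SUP g\<in>translation_hull f. semi_distance ((\<lambda>v. \<phi> t v g) ` M) (p ` translation_hull f)) \<le> D t"
    if t: "t \<ge> 0" for t
    unfolding semi_distance_def image_image
  proof (intro SUP_least)
    fix g v assume g: "g \<in> translation_hull f" and v: "v \<in> M"
    have g': "g \<in> bounded_forcing C" using g C by blast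
    have "dist (\<phi> t v g) (p (translate t g)) \<le> exp (- \<kappa> * t / 2) * norm (v - p g)"
      using cocycle_contraction[OF g' t, of v "p g"] cocycle_p[OF g' t] by (simp add: dist_norm)
    also have "\<dots> \<le> exp (- \<kappa> * t / 2) * (R + C / \<kappa>)"
      using R[OF v] norm_p_le[OF g'] norm_triangle_ineq4[of v "p g"]
      by (intro mult_left_mono) auto
    finally have "ennreal (dist (\<phi> t v g) (p (translate t g))) \<le> D t"
      unfolding D_def by (rule ennreal_leI)
    then show "(INF g'\<in>translation_hull f. ennreal (dist (\<phi> t v g) (p g'))) \<le> D t"
      by (rule INF_lower2[OF translate_translation_hull[OF c g]])
  qed
  have D: "(D \<longlongrightarrow> 0) at_top"
    unfolding D_def using tendsto_ennrealI[OF exp_decay] by simp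
  show ?thesis
  proof (rule tendsto_sandwich[OF _ _ tendsto_const D])
    show "\<forall>\<^sub>F t in at_top. (SUP g\<in>translation_hull f.
        semi_distance ((\<lambda>v. \<phi> t v g) ` M) (p ` translation_hull f)) \<le> D t"
      using eventually_ge_at_top[of "0::real"] by eventually_elim (rule le)
  qed simp
qed

end

theorem theorem4p11:
  fixes \<nu> \<kappa> \<alpha> :: real and f :: "real \<Rightarrow> ell2" and F :: "real \<Rightarrow> real"
  assumes "\<nu> > 0" and "\<kappa> > 0" and "\<alpha> \<ge> 0"
    and "almost_periodic f"
    and "continuous_on UNIV F" and "lipschitz_on_bounded_sets F" and "F 0 = 0"
    and "\<And>x\<^sub>1 x\<^sub>2. (x\<^sub>1 - x\<^sub>2) * (F x\<^sub>1 - F x\<^sub>2) \<le> - \<alpha> * \<bar>x\<^sub>1 - x\<^sub>2\<bar>\<^sup>2"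
  shows "\<exists>I. compact_global_attractor (lattice_cocycle \<nu> \<kappa> F) (translation_hull f) translate I"
proof -
  have "antimono F"
  proof (rule antimonoI)
    fix x y :: real assume "x \<le> y"
    have "(x - y) * (F x - F y) \<le> - \<alpha> * \<bar>x - y\<bar>\<^sup>2" by (rule assms(8))
    also have "\<dots> \<le> 0" using \<open>\<alpha> \<ge> 0\<close> by simp
    finally show "F y \<le> F x" using \<open>x \<le> y\<close> by (cases "x = y") (auto simp: mult_le_0_iff)
  qed
  then interpret dissipative_lattice \<nu> \<kappa> F
    using assms by unfold_locales
  obtain C where C: "translation_hull f \<subseteq> bounded_forcing C"
    using translation_hull_bounded_forcing[OF assms(4)] by blast
  have U: "(\<Union>g\<in>translation_hull f. {p g}) = p ` translation_hull f" by blast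
  \<comment> \<open>The fibres are single points, so invariance is exactly
    \<open>cocycle_p\<close>.\<close>
  have "compact_global_attractor \<phi> (translation_hull f) translate (\<lambda>g. {p g})"
    unfolding compact_global_attractor_def U
  proof (intro conjI allI impI ballI)
    show "(\<lambda>v. \<phi> t v g) ` {p g} = {p (translate t g)}" if "t \<ge> 0" "g \<in> translation_hull f" for t g
      using cocycle_p[of g C t] that C by auto
  qed (simp_all add: compact_closure_p_hull p_hull_attracts assms(4))
  then show ?thesis by blast
qed

end
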